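(* Let $\Omega\subset\mathbb{R}^N$, $N\ge2$, be a bounded radial open set (not necessarily connected), let $s\in(0,1)$, and let $f:[0,\infty)\times\mathbb{R}\to\mathbb{R}$ satisfy: for every $K>0$ there is $L=L(K)>0$ such that $\sup_{r\in[0,\infty)}|f(r,u)-f(r,v)|\le L|u-v|$ for all $u,v\in[-K,K]$. Let $u$ be a continuous bounded weak solution of $(-\Delta)^s u=f(|x|,u)$ in $\Omega$, $u\equiv0$ on $\mathbb{R}^N\setminus\Omega$, $\lim_{|x|\to\infty}u(x)=0$. Suppose there is $e_1\in S^{N-1}$ such that, with $H_{e_1}=\{x\in\mathbb{R}^N: x\cdot e_1>0\}$ and $Q_{H_{e_1}}$ the reflection at $\partial H_{e_1}$, we have $u\ge u\circ Q_{H_{e_1}}$ and $u\not\equiv u\circ Q_{H_{e_1}}$ on $H_{e_1}$. Then $u$ is foliated Schwarz symmetric.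
   Context: A weak solution means $u\in\mathcal{H}^s_0(\Omega)=\{u\in H^s(\mathbb{R}^N): u\equiv0 \text{ on } \mathbb{R}^N\setminus\Omega\}$ and for all $\varphi\in\mathcal{H}^s_0(\Omega)$ with compact support, $\frac{c_{N,s}}{2}\iint\frac{(u(x)-u(y))(\varphi(x)-\varphi(y))}{|x-y|^{N+2s}}dxdy=\int_\Omega f(|x|,u)\varphi\,dx$. Foliated Schwarz symmetric means: there is $p\in S^{N-1}$ such that for every $r>0$ with $r$-sphere meeting the domain and every $c\in\mathbb{R}$, the set $\{x\in rS^{N-1}: u(x)\ge c\}$ is either $rS^{N-1}$ or a geodesic ball in $rS^{N-1}$ centered at $rp$ (equivalently, $u$ is axially symmetric about $\mathbb{R}p$ and nonincreasing in the polar angle). *)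

theory Defs
  imports "HOL-Analysis.Analysis"
begin

text \<open>Normalisation constant of the fractional Laplacian in dimension N.\<close>
definition c_Ns :: "nat \<Rightarrow> real \<Rightarrow> real" where
  "c_Ns N s = s * 4 powr s * Gamma (real N / 2 + s) / (pi powr (real N / 2) * Gamma (1 - s))"

definition in_Hs :: "real \<Rightarrow> ('a::euclidean_space \<Rightarrow> real) \<Rightarrow> bool" where
  "in_Hs s u \<longleftrightarrow> u \<in> borel_measurable lborel
     \<and> integrable lborel (\<lambda>x. (u x)\<^sup>2)
     \<and> integrable (lborel :: ('a \<times> 'a) measure)
         (\<lambda>(x, y). (u x - u y)\<^sup>2 / norm (x - y) powr (real DIM('a) + 2 * s))"

definition in_Hs0 :: "real \<Rightarrow> 'a::euclidean_space set \<Rightarrow> ('a \<Rightarrow> real) \<Rightarrow> bool" where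
  "in_Hs0 s \<Omega> u \<longleftrightarrow> in_Hs s u \<and> (\<forall>x. x \<notin> \<Omega> \<longrightarrow> u x = 0)"

definition weak_solution ::
  "real \<Rightarrow> 'a::euclidean_space set \<Rightarrow> (real \<Rightarrow> real \<Rightarrow> real) \<Rightarrow> ('a \<Rightarrow> real) \<Rightarrow> bool" where
  "weak_solution s \<Omega> f u \<longleftrightarrow> in_Hs0 s \<Omega> u \<and>
     (\<forall>\<phi>. in_Hs0 s \<Omega> \<phi> \<and> compact (closure {x. \<phi> x \<noteq> 0}) \<and> closure {x. \<phi> x \<noteq> 0} \<subseteq> \<Omega> \<longrightarrow>
        c_Ns DIM('a) s / 2 *
          integral\<^sup>L (lborel :: ('a \<times> 'a) measure)
            (\<lambda>(x, y). (u x - u y) * (\<phi> x - \<phi> y) / norm (x - y) powr (real DIM('a) + 2 * s))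
        = (LINT x:\<Omega>|lborel. f (norm x) (u x) * \<phi> x))"

definition radial_set :: "'a::real_normed_vector set \<Rightarrow> bool" where
  "radial_set \<Omega> \<longleftrightarrow> (\<forall>x y. norm x = norm y \<longrightarrow> (x \<in> \<Omega> \<longleftrightarrow> y \<in> \<Omega>))"

definition refl_hp :: "'a::real_inner \<Rightarrow> 'a \<Rightarrow> 'a" where
  "refl_hp e x = x - (2 * (x \<bullet> e)) *\<^sub>R e"

definition geodesic_ball :: "real \<Rightarrow> 'a::euclidean_space \<Rightarrow> real \<Rightarrow> 'a set \<Rightarrow> bool" where
  "geodesic_ball r p \<rho> S \<longleftrightarrow>
     S = {x \<in> sphere 0 r. r * arccos ((x \<bullet> p) / r) < r * \<rho>} \<or>
     S = {x \<in> sphere 0 r. r * arccos ((x \<bullet> p) / r) \<le> r * \<rho>}"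

definition foliated_schwarz_symmetric :: "'a::euclidean_space set \<Rightarrow> ('a \<Rightarrow> real) \<Rightarrow> bool" where
  "foliated_schwarz_symmetric \<Omega> u \<longleftrightarrow>
     (\<exists>p. norm p = 1 \<and>
        (\<forall>r>0. sphere 0 r \<inter> \<Omega> \<noteq> {} \<longrightarrow>
           (\<forall>c. {x \<in> sphere 0 r. c \<le> u x} = sphere 0 r \<or>
                (\<exists>\<rho>\<ge>0. geodesic_ball r p \<rho> {x \<in> sphere 0 r. c \<le> u x}))))"

end

theory Submission
  imports Defs
begin

text \<open>
  For a unit vector \<open>e\<close> write \<open>w\<^sub>e = u - u \<circ> Q\<^sub>e\<close>, where \<open>Q\<^sub>e\<close> is the reflection at the hyperplane
  orthogonal to \<open>e\<close>, and let \<open>P\<close> be the set of all \<open>e\<close> with \<open>w\<^sub>e \<ge> 0\<close>, \<open>w\<^sub>e \<noteq> 0\<close> on the half space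
  \<open>x \<bullet> e > 0\<close>. The vector \<open>p = \<integral> u(x) x dx\<close> satisfies \<open>2 p \<bullet> e = \<integral> w\<^sub>e(x) (x \<bullet> e) dx\<close>, hence \<open>P\<close> lies in
  the open hemisphere \<open>p \<bullet> e > 0\<close>, and a limit of \<open>P\<close> in that hemisphere cannot have \<open>w\<^sub>e = 0\<close>, so \<open>P\<close>
  is closed in it. If \<open>P\<close> is also open, it is the whole (connected) hemisphere, and comparing two
  points of a sphere by the reflection that swaps them gives the symmetry with respect to \<open>p\<close>.

  Openness at \<open>e\<^sub>0\<close> replaces the strong maximum principle: for \<open>e\<close> near \<open>e\<^sub>0\<close>, testing the equation with the
  antisymmetric function built from \<open>(w\<^sub>e + \<epsilon>)\<^sup>-\<close> bounds the nonlocal interaction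
  energy of the negative part by \<open>L \<integral> \<phi> |w\<^sub>e|\<close>. This is impossible: close to the
  hyperplane the interaction with the reflected half space has an arbitrarily large coefficient, and
  away from it the interaction with a fixed ball on which \<open>w\<^sub>e\<close> is bounded below is linear in \<open>\<phi>\<close>,
  whereas \<open>|w\<^sub>e|\<close> is uniformly small where \<open>w\<^sub>e\<close> is negative.
\<close>

section \<open>Involutive isometries and Lebesgue measure\<close>

text \<open>Vitali: an open set is, up to a null set, a disjoint union of balls, whose measure depends only on the radius.\<close>
lemma emeasure_le_vimage_involutive_isometry:
  fixes T :: "'a::euclidean_space \<Rightarrow> 'a"
  assumes iso: "\<And>x y. dist (T x) (T y) = dist x y" and inv: "\<And>x. T (T x) = x"
    and S: "open S"
  shows "emeasure lborel S \<le> emeasure lborel (T -` S)"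
proof -
  define K where "K = {(c::'a, r::real). 0 < r \<and> ball c r \<subseteq> S}"
  have "\<exists>i. i \<in> K \<and> x \<in> ball (fst i) (snd i) \<and> snd i < d" if x: "x \<in> S" and d: "0 < d" for x d
  proof -
    obtain e where e: "e > 0" "ball x e \<subseteq> S"
      using S x openE by blast
    then have "ball x (min e (d/2)) \<subseteq> S"
      by (meson min.cobounded1 subset_ball subset_trans)
    with e d show ?thesis
      by (intro exI[of _ "(x, min e (d/2))"]) (auto simp: K_def)
  qed
  then obtain C where C: "countable C" "C \<subseteq> K"
     "pairwise (\<lambda>i j. disjnt (ball (fst i) (snd i)) (ball (fst j) (snd j))) C"
     "negligible (S - (\<Union>i \<in> C. ball (fst i) (snd i)))"
    by (rule Vitali_covering_theorem_balls[of S K fst snd])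
  let ?U = "\<Union>i\<in>C. ball (fst i) (snd i)"
  have cont: "continuous_on UNIV T"
    using iso by (force simp: continuous_on_iff)
  have T_ball: "T -` ball c r = ball (T c) r" for c r
    using iso[of "T c"] by (auto simp: inv)
  have disj: "disjoint_family_on (\<lambda>i. ball (fst i) (snd i)) C"
    using C(3) by (auto simp: disjoint_family_on_def pairwise_def disjnt_def)
  have disjT: "disjoint_family_on (\<lambda>i. ball (T (fst i)) (snd i)) C"
    using disj unfolding T_ball[symmetric] disjoint_family_on_def by blast
  have "open ?U" by blast
  then have "S - ?U \<in> null_sets lborel"
    using C(4) S by (auto simp: negligible_iff_null_sets null_sets_completion_iff)
  then have "AE x in lborel. x \<in> S \<longrightarrow> x \<in> ?U"
    by (rule AE_not_in[THEN eventually_mono]) blast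
  then have "emeasure lborel S \<le> emeasure lborel ?U"
    using \<open>open ?U\<close> by (intro emeasure_mono_AE) simp_all
  also have "\<dots> = (\<integral>\<^sup>+i. emeasure lborel (ball (fst i) (snd i)) \<partial>count_space C)"
    using C(1) disj by (intro emeasure_UN_countable) auto
  also have "\<dots> = (\<integral>\<^sup>+i. emeasure lborel (ball (T (fst i)) (snd i)) \<partial>count_space C)"
    using C(2) by (intro nn_integral_cong) (auto simp: K_def emeasure_ball)
  also have "\<dots> = emeasure lborel (\<Union>i\<in>C. ball (T (fst i)) (snd i))"
    using C(1) disjT by (intro emeasure_UN_countable[symmetric]) auto
  also have "\<dots> \<le> emeasure lborel (T -` S)"
  proof (rule emeasure_mono)
    show "(\<Union>i\<in>C. ball (T (fst i)) (snd i)) \<subseteq> T -` S"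
      using C(2) unfolding T_ball[symmetric] by (force simp: K_def)
    show "T -` S \<in> sets lborel"
      using continuous_open_vimage[OF S, of T] cont by (simp add: continuous_on_eq_continuous_at)
  qed
  finally show ?thesis .
qed

text \<open>The inequality for open sets is applied to a box and to its preimage; since
  \<open>T\<close> is its own inverse, the two bounds are converse to each other. Agreement on boxes
  identifies Lebesgue measure.\<close>

lemma lborel_distr_involutive_isometry:
  fixes T :: "'a::euclidean_space \<Rightarrow> 'a"
  assumes iso: "\<And>x y. dist (T x) (T y) = dist x y" and inv: "\<And>x. T (T x) = x"
  shows "distr lborel borel T = lborel"
proof (rule lborel_eqI[symmetric])
  fix l u :: 'a assume "\<And>b. b \<in> Basis \<Longrightarrow> l \<bullet> b \<le> u \<bullet> b"
  then have box: "emeasure lborel (box l u) = (\<Prod>b\<in>Basis. (u - l) \<bullet> b)"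
    by simp
  have cont: "continuous_on UNIV T"
    using iso by (force simp: continuous_on_iff)
  then have meas [measurable]: "T \<in> borel_measurable borel"
    by (rule borel_measurable_continuous_onI)
  have "open (T -` box l u)"
    by (intro open_vimage cont) auto
  then have "emeasure lborel (T -` box l u) \<le> emeasure lborel (T -` (T -` box l u))"
    by (rule emeasure_le_vimage_involutive_isometry[OF iso inv])
  also have "T -` (T -` box l u) = box l u"
    by (auto simp only: vimage_def inv mem_Collect_eq)
  finally have "emeasure lborel (T -` box l u) = emeasure lborel (box l u)"
    using emeasure_le_vimage_involutive_isometry[OF iso inv open_box] by (rule antisym)
  then show "emeasure (distr lborel borel T) (box l u) = (\<Prod>b\<in>Basis. (u - l) \<bullet> b)"
    unfolding box by (subst emeasure_distr) simp_all
qed simp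

text \<open>Measurability of \<open>g\<close> need not be known in advance: integrability passes
  from \<open>g\<close> to its composition with \<open>T\<close>, and back because \<open>T\<close>
  is an involution. If neither is integrable, both integrals have the default value 0.\<close>

lemma
  fixes T :: "'a::euclidean_space \<Rightarrow> 'a" and g :: "'a \<Rightarrow> real"
  assumes iso: "\<And>x y. dist (T x) (T y) = dist x y" and inv: "\<And>x. T (T x) = x"
  shows integrable_involutive_isometry:
      "integrable lborel (\<lambda>x. g (T x)) \<longleftrightarrow> integrable lborel g"
    and integral_involutive_isometry:
      "(\<integral>x. g (T x) \<partial>lborel) = (\<integral>x. g x \<partial>lborel)"
proof -
  have T: "T \<in> borel_measurable borel"
    using iso by (intro borel_measurable_continuous_onI) (force simp: continuous_on_iff)
  have imp: "integrable lborel (\<lambda>x. h (T x)) \<and> (\<integral>x. h (T x) \<partial>lborel) = (\<integral>x. h x \<partial>lborel)"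
    if "integrable lborel h" for h :: "'a \<Rightarrow> real"
  proof -
    have "integrable (distr lborel borel T) h"
      using that by (simp add: lborel_distr_involutive_isometry[OF iso inv])
    moreover have "h \<in> borel_measurable borel"
      using that by auto
    ultimately show ?thesis
      using T integral_distr[of T lborel borel h] integrable_distr_eq[of T lborel borel h]
      by (simp add: lborel_distr_involutive_isometry[OF iso inv])
  qed
  show *: "integrable lborel (\<lambda>x. g (T x)) \<longleftrightarrow> integrable lborel g"
    using imp[of g] imp[of "\<lambda>x. g (T x)"] by (auto simp: inv)
  show "(\<integral>x. g (T x) \<partial>lborel) = (\<integral>x. g x \<partial>lborel)"
    using imp[of g] * by (cases "integrable lborel g") (auto simp: not_integrable_integral_eq)
qed

section \<open>Reflections and the kernel\<close>

text \<open>The junk value at \<open>0\<close> is \<open>0\<close>, so the monotonicity below needs \<open>z \<noteq> 0\<close>.\<close>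
definition kern :: "real \<Rightarrow> 'a::real_normed_vector \<Rightarrow> real" where
  "kern q z = 1 / norm z powr q"

lemma kern_nonneg [simp]: "0 \<le> kern q z"
  by (simp add: kern_def)

lemma kern_antimono:
  assumes "0 \<le> q" "z \<noteq> 0" "norm z \<le> norm z'"
  shows "kern q z' \<le> kern q z"
  using assms by (auto simp: kern_def intro!: divide_left_mono powr_mono2 mult_pos_pos)

lemma borel_measurable_kern [measurable]:
  "(kern q :: 'a::euclidean_space \<Rightarrow> real) \<in> borel_measurable borel"
  unfolding kern_def by measurable

lemma refl_hp_inner: "norm e = 1 \<Longrightarrow> refl_hp e x \<bullet> e = - (x \<bullet> e)"
  by (simp add: refl_hp_def inner_diff_left norm_eq_1)

lemma refl_hp_involutive: "norm e = 1 \<Longrightarrow> refl_hp e (refl_hp e x) = x"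
  using refl_hp_inner[of e x] by (simp add: refl_hp_def[of e "refl_hp e x"]) (simp add: refl_hp_def)

lemma refl_hp_diff: "refl_hp e x - refl_hp e y = refl_hp e (x - y)"
  by (simp add: refl_hp_def inner_diff_left algebra_simps)

text \<open>The source of all kernel comparisons: whether reflecting one point increases the
  distance depends only on the sign of the last term, that is, on whether \<open>x\<close> and
  \<open>y\<close> lie on the same side of the hyperplane.\<close>

lemma norm_diff_refl_hp_sq:
  "norm e = 1 \<Longrightarrow> (norm (x - refl_hp e y))\<^sup>2 = (norm (x - y))\<^sup>2 + 4 * (x \<bullet> e) * (y \<bullet> e)"
  by (simp add: refl_hp_def power2_norm_eq_inner norm_eq_1 inner_diff_left inner_diff_right
      inner_add_left inner_add_right inner_commute algebra_simps)

lemma norm_refl_hp: "norm e = 1 \<Longrightarrow> norm (refl_hp e x) = norm x"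
  using norm_diff_refl_hp_sq[of e 0 x] by simp

lemma dist_refl_hp: "norm e = 1 \<Longrightarrow> dist (refl_hp e x) (refl_hp e y) = dist x y"
  by (simp add: dist_norm refl_hp_diff norm_refl_hp)

lemma continuous_on_refl_hp [continuous_intros]:
  "continuous_on S f \<Longrightarrow> continuous_on S g \<Longrightarrow> continuous_on S (\<lambda>x. refl_hp (f x) (g x))"
  unfolding refl_hp_def by (intro continuous_intros)

lemma borel_measurable_refl_hp [measurable]:
  "refl_hp e \<in> borel_measurable (borel :: 'a::euclidean_space measure)"
  by (intro borel_measurable_continuous_onI continuous_intros)

section \<open>The Gagliardo form on the fractional Sobolev space\<close>

lemma borel_measurable_on_prod:
  "f \<in> borel_measurable (borel \<Otimes>\<^sub>M borel) \<Longrightarrow>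
   f \<in> borel_measurable (lborel :: ('a::euclidean_space \<times> 'a) measure)"
  by (simp add: borel_prod)

text \<open>Both claims follow by domination: the product of two increments is at most the sum of
  their squares, and the square of a difference is at most twice the sum of the squares.\<close>

lemma
  fixes u :: "'a::euclidean_space \<Rightarrow> real"
  assumes u: "in_Hs s u" and v: "in_Hs s v"
  shows in_Hs_integrable_bilinear:
      "integrable (lborel :: ('a \<times> 'a) measure)
        (\<lambda>(x, y). (u x - u y) * (v x - v y) * kern (real DIM('a) + 2 * s) (x - y))" (is ?A)
    and in_Hs_diff: "in_Hs s (\<lambda>x. u x - v x)"
proof -
  let ?k = "kern (real DIM('a) + 2 * s) :: 'a \<Rightarrow> real"
  have [measurable]: "u \<in> borel_measurable borel" "v \<in> borel_measurable borel"
    using u v by (auto simp: in_Hs_def)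
  have I: "integrable (lborel :: ('a \<times> 'a) measure) (\<lambda>(x, y). (h x - h y)\<^sup>2 * ?k (x - y))"
    if "in_Hs s h" for h :: "'a \<Rightarrow> real"
    using that by (simp add: in_Hs_def kern_def)
  note Iu = I[OF u] and Iv = I[OF v]
  show ?A
  proof (rule Bochner_Integration.integrable_bound[OF Bochner_Integration.integrable_add[OF Iu Iv]])
    show "(\<lambda>(x, y). (u x - u y) * (v x - v y) * ?k (x - y)) \<in> borel_measurable lborel"
      by (rule borel_measurable_on_prod) measurable
    have *: "\<bar>a * b * k\<bar> \<le> a\<^sup>2 * k + b\<^sup>2 * k" if "0 \<le> k" for a b k :: real
    proof -
      have "2 * \<bar>a * b\<bar> \<le> a\<^sup>2 + b\<^sup>2"
        using sum_squares_bound[of "\<bar>a\<bar>" "\<bar>b\<bar>"] by (simp add: abs_mult)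
      then have "\<bar>a * b\<bar> \<le> a\<^sup>2 + b\<^sup>2"
        using abs_ge_zero[of "a * b"] by linarith
      with that show ?thesis
        by (auto simp: abs_mult distrib_right[symmetric] intro!: mult_right_mono)
    qed
    show "AE x in lborel. norm (case x of (x, y) \<Rightarrow> (u x - u y) * (v x - v y) * ?k (x - y))
       \<le> norm ((case x of (x, y) \<Rightarrow> (u x - u y)\<^sup>2 * ?k (x - y)) +
              (case x of (x, y) \<Rightarrow> (v x - v y)\<^sup>2 * ?k (x - y)))"
      by (intro AE_I2) (simp add: case_prod_unfold *[OF kern_nonneg])
  qed
  have "integrable lborel (\<lambda>x. (u x - v x)\<^sup>2)"
  proof (rule Bochner_Integration.integrable_bound)
    show "integrable lborel (\<lambda>x. 2 * ((u x)\<^sup>2 + (v x)\<^sup>2))"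
      using u v by (auto simp: in_Hs_def)
    have "(a - b)\<^sup>2 \<le> 2 * (a\<^sup>2 + b\<^sup>2)" for a b :: real
      using zero_le_power2[of "a + b"] by (simp add: power2_eq_square algebra_simps)
    then show "AE x in lborel. norm ((u x - v x)\<^sup>2) \<le> norm (2 * ((u x)\<^sup>2 + (v x)\<^sup>2))"
      by simp
  qed measurable
  moreover have "integrable (lborel :: ('a \<times> 'a) measure)
     (\<lambda>(x, y). ((u x - v x) - (u y - v y))\<^sup>2 * ?k (x - y))"
  proof (rule Bochner_Integration.integrable_bound)
    show "integrable (lborel :: ('a \<times> 'a) measure)
       (\<lambda>p. 2 * ((case p of (x, y) \<Rightarrow> (u x - u y)\<^sup>2 * ?k (x - y)) + (case p of (x, y) \<Rightarrow> (v x - v y)\<^sup>2 * ?k (x - y))))"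
      using Iu Iv by simp
    show "(\<lambda>(x, y). ((u x - v x) - (u y - v y))\<^sup>2 * ?k (x - y)) \<in> borel_measurable lborel"
      by (rule borel_measurable_on_prod) measurable
    have *: "((a - b) - (c - d))\<^sup>2 * k \<le> 2 * ((a - c)\<^sup>2 * k) + 2 * ((b - d)\<^sup>2 * k)" if "0 \<le> k" for a b c d k :: real
    proof -
      have "((a - b) - (c - d))\<^sup>2 \<le> 2 * ((a - c)\<^sup>2 + (b - d)\<^sup>2)"
        using zero_le_power2[of "(a - c) + (b - d)"] by (simp add: power2_eq_square algebra_simps)
      from mult_right_mono[OF this that] show ?thesis
        by (simp add: algebra_simps)
    qed
    show "AE p in lborel. norm (case p of (x, y) \<Rightarrow> ((u x - v x) - (u y - v y))\<^sup>2 * ?k (x - y))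
       \<le> norm (2 * ((case p of (x, y) \<Rightarrow> (u x - u y)\<^sup>2 * ?k (x - y)) + (case p of (x, y) \<Rightarrow> (v x - v y)\<^sup>2 * ?k (x - y))))"
      by (intro AE_I2) (auto simp: abs_of_nonneg intro!: *[OF kern_nonneg])
  qed
  ultimately show "in_Hs s (\<lambda>x. u x - v x)"
    by (simp add: in_Hs_def kern_def)
qed

text \<open>Reflecting both variables is an involutive isometry of the product space, and it
  preserves the kernel.\<close>

lemma in_Hs_refl_hp:
  fixes u :: "'a::euclidean_space \<Rightarrow> real"
  assumes e: "norm e = 1" and u: "in_Hs s u"
  shows "in_Hs s (\<lambda>x. u (refl_hp e x))"
proof -
  let ?T = "\<lambda>p::'a \<times> 'a. (refl_hp e (fst p), refl_hp e (snd p))"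
  have [measurable]: "u \<in> borel_measurable borel"
    using u by (auto simp: in_Hs_def)
  have "integrable lborel (\<lambda>x. (u (refl_hp e x))\<^sup>2)"
    using u integrable_involutive_isometry[of "refl_hp e" "\<lambda>x. (u x)\<^sup>2"]
    by (simp add: in_Hs_def dist_refl_hp refl_hp_involutive e)
  moreover have "integrable lborel (\<lambda>p. (\<lambda>(x, y). (u x - u y)\<^sup>2 / norm (x - y) powr (real DIM('a) + 2 * s)) (?T p))"
    using u by (subst integrable_involutive_isometry)
      (auto simp: in_Hs_def dist_refl_hp refl_hp_involutive e dist_prod_def)
  ultimately show ?thesis
    by (simp add: in_Hs_def refl_hp_diff norm_refl_hp e case_prod_unfold)
qed

section \<open>Truncated antisymmetric functions\<close>

lemma kern_diff_le_refl_hp: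
  assumes e: "norm e = 1" and q: "0 \<le> q" and sgn: "0 \<le> (x \<bullet> e) * (y \<bullet> e)" and ne: "x \<noteq> y"
  shows "kern q (x - refl_hp e y) \<le> kern q (x - y)"
proof (rule kern_antimono)
  have "(norm (x - y))\<^sup>2 \<le> (norm (x - refl_hp e y))\<^sup>2"
    using sgn by (simp add: norm_diff_refl_hp_sq[OF e])
  then show "norm (x - y) \<le> norm (x - refl_hp e y)"
    by (rule power2_le_imp_le) simp
qed (use q ne in auto)

lemma kern_refl_hp_le_diff:
  assumes e: "norm e = 1" and q: "0 \<le> q" and sgn: "(x \<bullet> e) * (y \<bullet> e) \<le> 0" and ne: "x \<noteq> refl_hp e y"
  shows "kern q (x - y) \<le> kern q (x - refl_hp e y)"
  using kern_diff_le_refl_hp[of e q x "refl_hp e y"] assms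
  by (simp add: refl_hp_involutive refl_hp_inner)

text \<open>This is the negative part of \<open>w + \<epsilon>\<close> on the half space, continued
  oddly under the reflection when \<open>w\<close> itself is odd. The shift confines it to points
  with \<open>\<bar>w x\<bar> \<ge> \<epsilon>\<close>, which yields compact support inside the
  domain.\<close>

definition anti_trunc :: "'a::real_inner \<Rightarrow> real \<Rightarrow> ('a \<Rightarrow> real) \<Rightarrow> 'a \<Rightarrow> real" where
  "anti_trunc e \<epsilon> w x =
     (if x \<bullet> e > 0 then max 0 (- \<epsilon> - w x) else if x \<bullet> e < 0 then - max 0 (- \<epsilon> + w x) else 0)"

lemma borel_measurable_anti_trunc [measurable]:
  fixes w :: "'a::euclidean_space \<Rightarrow> real"
  assumes [measurable]: "w \<in> borel_measurable borel"
  shows "anti_trunc e \<epsilon> w \<in> borel_measurable borel"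
  unfolding anti_trunc_def by measurable

lemma anti_trunc_refl_hp:
  assumes "norm e = 1" "\<And>x. w (refl_hp e x) = - w x"
  shows "anti_trunc e \<epsilon> w (refl_hp e x) = - anti_trunc e \<epsilon> w x"
  using assms by (simp add: anti_trunc_def refl_hp_inner)

lemma abs_anti_trunc_le: "0 \<le> \<epsilon> \<Longrightarrow> \<bar>anti_trunc e \<epsilon> w x\<bar> \<le> \<bar>w x\<bar>"
  by (auto simp: anti_trunc_def)

lemma anti_trunc_nonzero: "0 \<le> \<epsilon> \<Longrightarrow> anti_trunc e \<epsilon> w x \<noteq> 0 \<Longrightarrow> \<epsilon> \<le> \<bar>w x\<bar>"
  by (auto simp: anti_trunc_def max_def split: if_splits)

text \<open>Here \<open>a\<close>, \<open>b\<close> stand for the values of \<open>w\<close> at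
  \<open>x\<close>, \<open>y\<close>, and \<open>k1\<close>, \<open>k2\<close> for the kernel at the
  pair and at the pair with \<open>y\<close> reflected. Writing \<open>k1 = (k1 - k2) + k2\<close>,
  the \<open>k2\<close> terms collapse to products \<open>t * m t\<close>, which are nonpositive,
  and the remainder is controlled by the monotonicity of \<open>m\<close>. The alternative
  \<open>a = b\<close> covers the diagonal.\<close>

lemma trunc_energy_scalar:
  fixes a b k1 k2 \<epsilon> :: real
  defines "m \<equiv> \<lambda>t. max 0 (- \<epsilon> - t)"
  assumes \<epsilon>: "0 \<le> \<epsilon>" and k: "0 \<le> k2" "k2 \<le> k1 \<or> a = b"
  shows "(a - b) * (m a - m b) * k1 + (a + b) * (m a + m b) * k2
    \<le> - (m a * (max 0 (k1 - k2) * max 0 b + 2 * k2 * \<bar>a\<bar>))"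
proof -
  have m_le: "t * m t \<le> - (m t * \<bar>t\<bar>)" for t
    using \<epsilon> by (cases "t < - \<epsilon>") (simp_all add: m_def)
  have m_0: "t * m t \<le> 0" for t
    using m_le[of t] by (rule order_trans) (simp add: m_def)
  have ab: "(a - b) * (m a - m b) \<le> - (m a * max 0 b)"
  proof (cases "a < - \<epsilon>"; cases "b < - \<epsilon>")
    assume "a < - \<epsilon>" "b < - \<epsilon>"
    then have "(a - b) * (m a - m b) = - ((a - b) * (a - b))" "max 0 b = 0"
      using \<epsilon> by (simp_all add: m_def algebra_simps)
    then show ?thesis by simp
  next
    assume *: "a < - \<epsilon>" "\<not> b < - \<epsilon>"
    then have "(a - b) * m a \<le> (- max 0 b) * m a"
      using \<epsilon> by (intro mult_right_mono) (auto simp: m_def)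
    with * show ?thesis by (simp add: m_def mult.commute)
  next
    assume *: "\<not> a < - \<epsilon>" "b < - \<epsilon>"
    then have "0 \<le> (a - b) * m b"
      by (intro mult_nonneg_nonneg) (auto simp: m_def)
    moreover have "m a = 0"
      using * by (simp add: m_def)
    ultimately show ?thesis by simp
  next
    assume "\<not> a < - \<epsilon>" "\<not> b < - \<epsilon>"
    then have "m a = 0" "m b = 0"
      by (simp_all add: m_def)
    then show ?thesis by simp
  qed
  have kk: "(a - b) * (m a - m b) * (k1 - k2) \<le> - (m a * (max 0 (k1 - k2) * max 0 b))"
  proof (cases "k2 \<le> k1")
    case True
    then have "(a - b) * (m a - m b) * (k1 - k2) \<le> - (m a * max 0 b) * (k1 - k2)"
      by (intro mult_right_mono ab) simp
    also have "\<dots> = - (m a * ((k1 - k2) * max 0 b))"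
      by algebra
    finally show ?thesis
      using True by (simp only: max_absorb2 diff_ge_0_iff_ge)
  next
    case False
    with k(2) show ?thesis by simp
  qed
  have "(a - b) * (m a - m b) * k1 + (a + b) * (m a + m b) * k2
      = (a - b) * (m a - m b) * (k1 - k2) + 2 * k2 * (a * m a) + 2 * k2 * (b * m b)"
    by (simp add: algebra_simps)
  also have "\<dots> \<le> - (m a * (max 0 (k1 - k2) * max 0 b)) + 2 * k2 * (- (m a * \<bar>a\<bar>)) + 2 * k2 * 0"
    using k(1) by (intro add_mono kk mult_left_mono m_le m_0) auto
  finally show ?thesis by (simp add: algebra_simps)
qed

lemma trunc_energy_nonpos:
  fixes a b k1 k2 \<epsilon> :: real
  assumes "0 \<le> \<epsilon>" "0 \<le> k2" "k2 \<le> k1 \<or> a = b"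
  shows "(a - b) * (max 0 (- \<epsilon> - a) - max 0 (- \<epsilon> - b)) * k1
    + (a + b) * (max 0 (- \<epsilon> - a) + max 0 (- \<epsilon> - b)) * k2 \<le> 0"
  by (rule order_trans[OF trunc_energy_scalar[OF assms]]) (use assms in simp)

text \<open>Meant for points on opposite sides, with \<open>a\<close> and \<open>b\<close> the
  values of \<open>w\<close> at one point and at the mirror image of the other; the increment of the
  truncation is then \<open>m a + m b\<close> up to sign. It is at most
  \<open>\<bar>a + b\<bar>\<close> if \<open>a\<close> and \<open>b\<close> have the same sign and
  at most \<open>\<bar>a - b\<bar>\<close> otherwise; the second case is paid for by the larger
  kernel \<open>k2\<close>.\<close>

lemma trunc_sq_scalar:
  fixes a b k1 k2 \<epsilon> :: real
  defines "m \<equiv> \<lambda>t. max 0 (- \<epsilon> - t)"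
  assumes \<epsilon>: "0 \<le> \<epsilon>" and k: "0 \<le> k1" "0 \<le> k2" "k1 \<le> k2 \<or> a = b"
  shows "(m a + m b)\<^sup>2 * k1 \<le> (a + b)\<^sup>2 * k1 + (a - b)\<^sup>2 * k2"
proof -
  have m: "0 \<le> m a + m b" "m a + m b \<le> \<bar>a + b\<bar> \<or> m a + m b \<le> \<bar>a - b\<bar>"
    "a = b \<longrightarrow> m a + m b \<le> \<bar>a + b\<bar>"
    using \<epsilon> by (auto simp: m_def max_def abs_if)
  have sq: "(m a + m b)\<^sup>2 \<le> t\<^sup>2" if "m a + m b \<le> \<bar>t\<bar>" for t
    using m(1) that by (metis abs_of_nonneg abs_le_square_iff)
  show ?thesis
  proof (cases "m a + m b \<le> \<bar>a + b\<bar>")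
    case True
    from mult_right_mono[OF sq[OF this] k(1)] show ?thesis
      using k(2) by (simp add: add_increasing2)
  next
    case False
    with m k(3) have *: "m a + m b \<le> \<bar>a - b\<bar>" "k1 \<le> k2" by auto
    then have "(m a + m b)\<^sup>2 * k1 \<le> (a - b)\<^sup>2 * k2"
      using k by (intro mult_mono sq) auto
    then show ?thesis
      using k(1) by (simp add: add_increasing)
  qed
qed

context
  fixes e :: "'a::euclidean_space" and \<epsilon> q :: real and w :: "'a \<Rightarrow> real"
  assumes e: "norm e = 1" and \<epsilon>: "0 \<le> \<epsilon>" and q: "0 \<le> q"
    and w: "\<And>x. w (refl_hp e x) = - w x"
begin

lemma antisymmetric_0: "x \<bullet> e = 0 \<Longrightarrow> w x = 0"
  using w[of x] by (simp add: refl_hp_def)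

text \<open>On one side of the hyperplane truncation is a contraction. Across it this fails, because
  opposite signs of \<open>w\<close> are kept on the two sides, and the term with \<open>y\<close>
  reflected compensates.\<close>

lemma anti_trunc_sq_le:
  "(anti_trunc e \<epsilon> w x - anti_trunc e \<epsilon> w y)\<^sup>2 * kern q (x - y)
    \<le> (w x - w y)\<^sup>2 * kern q (x - y) + (w x + w y)\<^sup>2 * kern q (x - refl_hp e y)"
proof -
  let ?m = "\<lambda>t. max 0 (- \<epsilon> - t)"
  let ?p = "anti_trunc e \<epsilon> w"
  have lip: ?thesis if "\<bar>?p x - ?p y\<bar> \<le> \<bar>w x - w y\<bar>"
  proof -
    have "(?p x - ?p y)\<^sup>2 * kern q (x - y) \<le> (w x - w y)\<^sup>2 * kern q (x - y)"
      using that by (intro mult_right_mono) (simp_all add: abs_le_square_iff)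
    then show ?thesis by (simp add: add_increasing2)
  qed
  \<comment> \<open>At \<open>x = refl_hp e y\<close> the comparison breaks down, since
    \<open>kern q 0\<close> is 0, but there oddness of \<open>w\<close> gives the
    alternative.\<close>
  have opp: "kern q (x - y) \<le> kern q (x - refl_hp e y) \<or> w x = - w y" if "(x \<bullet> e) * (y \<bullet> e) < 0"
    using that kern_refl_hp_le_diff[OF e q, of x y] by (cases "x = refl_hp e y") (auto simp: w)
  consider "x \<bullet> e = 0 \<or> y \<bullet> e = 0" | "x \<bullet> e > 0" "y \<bullet> e > 0" | "x \<bullet> e < 0" "y \<bullet> e < 0"
    | "x \<bullet> e > 0" "y \<bullet> e < 0" | "x \<bullet> e < 0" "y \<bullet> e > 0"
    by linarith
  then show ?thesis
  proof cases
    case 1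
    have "\<bar>?p x - ?p y\<bar> \<le> \<bar>w x - w y\<bar>" if "x \<bullet> e = 0" for x y
      using that abs_anti_trunc_le[OF \<epsilon>, of e w y] by (simp add: antisymmetric_0 anti_trunc_def[of e \<epsilon> w x])
    from this[of x y] this[of y x] 1 show ?thesis
      by (intro lip) (auto simp only: abs_minus_commute)
  next
    case 4
    then show ?thesis
      using trunc_sq_scalar[OF \<epsilon>, of "kern q (x - y)" "kern q (x - refl_hp e y)" "w x" "- w y"] opp
      by (simp add: anti_trunc_def mult_pos_neg)
  next
    case 5
    with opp have "kern q (x - y) \<le> kern q (x - refl_hp e y) \<or> w y = - w x"
      by (auto simp: mult_neg_pos)
    from trunc_sq_scalar[OF \<epsilon> kern_nonneg kern_nonneg this] 5 show ?thesis
      unfolding power2_commute[of "w x"] power2_commute[of "?p x"]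
      by (simp add: anti_trunc_def add.commute)
  next
    case 2
    then show ?thesis
      by (intro lip) (auto simp: anti_trunc_def)
  next
    case 3
    then show ?thesis
      by (intro lip) (auto simp: anti_trunc_def)
  qed
qed

text \<open>The integrand is paired with its copy in which \<open>y\<close> is reflected, which
  makes the sum nonpositive at every pair of points. The quantitative gain is kept only for pairs in
  the half space; for points on opposite sides the two kernels exchange their roles.\<close>

lemma anti_trunc_energy_le:
  "(w x - w y) * (anti_trunc e \<epsilon> w x - anti_trunc e \<epsilon> w y) * kern q (x - y)
   + (w x + w y) * (anti_trunc e \<epsilon> w x + anti_trunc e \<epsilon> w y) * kern q (x - refl_hp e y)
   \<le> - (if x \<bullet> e > 0 \<and> y \<bullet> e > 0 then anti_trunc e \<epsilon> w x *
         (max 0 (kern q (x - y) - kern q (x - refl_hp e y)) * max 0 (w y)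
          + 2 * kern q (x - refl_hp e y) * \<bar>w x\<bar>) else 0)" (is "?L \<le> _")
proof -
  let ?k1 = "kern q (x - y)" and ?k2 = "kern q (x - refl_hp e y)"
  have same: "?k2 \<le> ?k1 \<or> w x = w y" if "(x \<bullet> e) * (y \<bullet> e) > 0"
    using that kern_diff_le_refl_hp[OF e q, of x y] by (cases "x = y") auto
  have opp: "?k1 \<le> ?k2 \<or> w x = - w y" if "(x \<bullet> e) * (y \<bullet> e) < 0"
    using that kern_refl_hp_le_diff[OF e q, of x y] by (cases "x = refl_hp e y") (auto simp: w)
  have sgn: "w z * anti_trunc e \<epsilon> w z \<le> 0" for z
    using \<epsilon> by (auto simp: anti_trunc_def max_def mult_le_0_iff)
  consider "x \<bullet> e = 0" | "y \<bullet> e = 0" | "x \<bullet> e > 0" "y \<bullet> e > 0" | "x \<bullet> e < 0" "y \<bullet> e < 0"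
    | "x \<bullet> e > 0" "y \<bullet> e < 0" | "x \<bullet> e < 0" "y \<bullet> e > 0"
    by linarith
  then show ?thesis
  proof cases
    case 1
    have "?L = (w y * anti_trunc e \<epsilon> w y) * (?k1 + ?k2)"
      using 1 by (simp add: antisymmetric_0 anti_trunc_def algebra_simps)
    also have "\<dots> \<le> 0"
      by (rule mult_nonpos_nonneg[OF sgn]) simp
    finally show ?thesis using 1 by simp
  next
    case 2
    have "?L = (w x * anti_trunc e \<epsilon> w x) * (?k1 + ?k2)"
      using 2 by (simp add: antisymmetric_0 anti_trunc_def algebra_simps)
    also have "\<dots> \<le> 0"
      by (rule mult_nonpos_nonneg[OF sgn]) simp
    finally show ?thesis using 2 by simp
  next
    case 3
    then show ?thesis
      using trunc_energy_scalar[OF \<epsilon>, of ?k2 ?k1 "w x" "w y"] same by (simp add: anti_trunc_def)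
  next
    case 4
    have "?L \<le> 0"
      using trunc_energy_nonpos[OF \<epsilon>, of ?k2 ?k1 "- w x" "- w y"] same 4
      by (simp add: anti_trunc_def mult_neg_neg algebra_simps)
    with 4 show ?thesis by simp
  next
    case 5
    have "?L \<le> 0"
      using trunc_energy_nonpos[OF \<epsilon>, of ?k1 ?k2 "w x" "- w y"] opp 5
      by (simp add: anti_trunc_def mult_pos_neg algebra_simps)
    with 5 show ?thesis by simp
  next
    case 6
    with opp have "?k1 \<le> ?k2 \<or> - w x = w y"
      by (auto simp: mult_neg_pos)
    from trunc_energy_nonpos[OF \<epsilon> kern_nonneg this] 6 have "?L \<le> 0"
      by (simp add: anti_trunc_def algebra_simps)
    with 6 show ?thesis by simp
  qed
qed

end

section \<open>The energy of the truncation\<close>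

text \<open>Reflecting one variable or both is an involutive isometry of the product space.\<close>

lemma integrable_energy_refl_hp:
  fixes e :: "'a::euclidean_space" and g :: "'a \<Rightarrow> 'a \<Rightarrow> real"
  assumes e: "norm e = 1"
  shows "integrable (lborel :: ('a \<times> 'a) measure) (\<lambda>(x, y). g x (refl_hp e y)) \<longleftrightarrow>
      integrable (lborel :: ('a \<times> 'a) measure) (\<lambda>(x, y). g x y)"
    and "integral\<^sup>L (lborel :: ('a \<times> 'a) measure) (\<lambda>(x, y). g x (refl_hp e y)) =
      integral\<^sup>L (lborel :: ('a \<times> 'a) measure) (\<lambda>(x, y). g x y)"
    and "integral\<^sup>L (lborel :: ('a \<times> 'a) measure) (\<lambda>(x, y). g (refl_hp e x) (refl_hp e y)) =
      integral\<^sup>L (lborel :: ('a \<times> 'a) measure) (\<lambda>(x, y). g x y)"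
  using integrable_involutive_isometry[of "\<lambda>(x, y). (x, refl_hp e y)" "\<lambda>(x, y). g x y"]
    integral_involutive_isometry[of "\<lambda>(x, y). (x, refl_hp e y)" "\<lambda>(x, y). g x y"]
    integral_involutive_isometry[of "\<lambda>(x, y). (refl_hp e x, refl_hp e y)" "\<lambda>(x, y). g x y"]
  by (simp_all add: case_prod_unfold dist_prod_def dist_refl_hp refl_hp_involutive e)

context
  fixes e :: "'a::euclidean_space" and \<epsilon> s :: real and u w :: "'a \<Rightarrow> real"
  assumes e: "norm e = 1" and \<epsilon>: "0 \<le> \<epsilon>" and s: "0 < s" and u: "in_Hs s u"
    and w_def: "w = (\<lambda>x. u x - u (refl_hp e x))"
begin

private abbreviation (input) "k \<equiv> kern (real DIM('a) + 2 * s) :: 'a \<Rightarrow> real"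
private abbreviation (input) "\<phi> \<equiv> anti_trunc e \<epsilon> w"

private lemma w_anti: "w (refl_hp e x) = - w x"
  by (simp add: w_def refl_hp_involutive e)

private lemma w_Hs: "in_Hs s w"
  unfolding w_def by (intro in_Hs_diff u in_Hs_refl_hp e)

private lemma w_meas [measurable]: "w \<in> borel_measurable borel"
  using w_Hs by (simp add: in_Hs_def)

private lemma q: "0 \<le> real DIM('a) + 2 * s"
  using s by simp

text \<open>The pointwise bound \<open>anti_trunc_sq_le\<close> dominates the increments; its second
  term is the first one after reflecting \<open>y\<close>, hence integrable too.\<close>

lemma in_Hs_anti_trunc: "in_Hs s (anti_trunc e \<epsilon> w)"
proof -
  have sq: "integrable lborel (\<lambda>x. (\<phi> x)\<^sup>2)"
  proof (rule Bochner_Integration.integrable_bound)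
    show "integrable lborel (\<lambda>x. (w x)\<^sup>2)"
      using w_Hs by (simp add: in_Hs_def)
    show "AE x in lborel. norm ((\<phi> x)\<^sup>2) \<le> norm ((w x)\<^sup>2)"
      using abs_anti_trunc_le[OF \<epsilon>, of e w] by (simp add: abs_le_square_iff)
  qed measurable
  have D: "integrable (lborel :: ('a \<times> 'a) measure) (\<lambda>(x, y). (w x - w y)\<^sup>2 * k (x - y))"
    using w_Hs by (simp add: in_Hs_def kern_def)
  have D': "integrable (lborel :: ('a \<times> 'a) measure) (\<lambda>(x, y). (w x + w y)\<^sup>2 * k (x - refl_hp e y))"
    using D integrable_energy_refl_hp(1)[OF e, of "\<lambda>x y. (w x - w y)\<^sup>2 * k (x - y)"]
    by (simp add: w_anti)
  have "integrable (lborel :: ('a \<times> 'a) measure) (\<lambda>(x, y). (\<phi> x - \<phi> y)\<^sup>2 * k (x - y))"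
  proof (rule Bochner_Integration.integrable_bound[OF Bochner_Integration.integrable_add[OF D D']])
    show "(\<lambda>(x, y). (\<phi> x - \<phi> y)\<^sup>2 * k (x - y)) \<in> borel_measurable lborel"
      by (rule borel_measurable_on_prod) measurable
    show "AE p in lborel. norm (case p of (x, y) \<Rightarrow> (\<phi> x - \<phi> y)\<^sup>2 * k (x - y)) \<le>
      norm ((case p of (x, y) \<Rightarrow> (w x - w y)\<^sup>2 * k (x - y)) +
        (case p of (x, y) \<Rightarrow> (w x + w y)\<^sup>2 * k (x - refl_hp e y)))"
      using anti_trunc_sq_le[where w = w, OF e \<epsilon> q w_anti] by (simp add: case_prod_unfold)
  qed
  with sq show ?thesis
    by (simp add: in_Hs_def kern_def)
qed

text \<open>The factor 4 is twice 2. Oddness of the truncation makes the reflected copy of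
  \<open>u\<close> contribute minus the form of \<open>u\<close>, so \<open>w\<close> gives twice
  that form; and adding the copy with \<open>y\<close> reflected doubles the integral once
  more.\<close>

lemma energy_anti_trunc:
  "(\<integral>\<^sup>+x. \<integral>\<^sup>+y. ennreal (if x \<bullet> e > 0 \<and> y \<bullet> e > 0 then anti_trunc e \<epsilon> w x *
         (max 0 (k (x - y) - k (x - refl_hp e y)) * max 0 (w y)
          + 2 * k (x - refl_hp e y) * \<bar>w x\<bar>) else 0) \<partial>lborel \<partial>lborel)
   \<le> ennreal (- 4 * integral\<^sup>L (lborel :: ('a \<times> 'a) measure)
       (\<lambda>(x, y). (u x - u y) * (anti_trunc e \<epsilon> w x - anti_trunc e \<epsilon> w y) * k (x - y)))"
  (is "(\<integral>\<^sup>+x. \<integral>\<^sup>+y. ennreal (?G x y) \<partial>lborel \<partial>lborel) \<le> ennreal (- 4 * ?B u)")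
proof -
  let ?F = "\<lambda>x y. (w x - w y) * (\<phi> x - \<phi> y) * k (x - y)"
  let ?F' = "\<lambda>x y. (w x + w y) * (\<phi> x + \<phi> y) * k (x - refl_hp e y)"
  have \<phi>_anti: "\<phi> (refl_hp e x) = - \<phi> x" for x
    by (rule anti_trunc_refl_hp[OF e]) (rule w_anti)
  have k_refl: "k (refl_hp e x - refl_hp e y) = k (x - y)" for x y
    by (simp add: refl_hp_diff kern_def norm_refl_hp e)
  have "(\<lambda>(x, y). (u (refl_hp e x) - u (refl_hp e y)) * (\<phi> x - \<phi> y) * k (x - y)) =
    (\<lambda>p. - (case p of (x, y) \<Rightarrow> (u (refl_hp e x) - u (refl_hp e y)) *
        (\<phi> (refl_hp e x) - \<phi> (refl_hp e y)) * k (refl_hp e x - refl_hp e y)))"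
    unfolding \<phi>_anti k_refl by (rule ext) (simp add: case_prod_unfold algebra_simps)
  then have "?B (\<lambda>x. u (refl_hp e x)) = - ?B u"
    using integrable_energy_refl_hp(3)[OF e, of "\<lambda>x y. (u x - u y) * (\<phi> x - \<phi> y) * k (x - y)"]
    by simp
  moreover have "?B w = ?B u - ?B (\<lambda>x. u (refl_hp e x))"
    using in_Hs_integrable_bilinear[OF u in_Hs_anti_trunc]
      in_Hs_integrable_bilinear[OF in_Hs_refl_hp[OF e u] in_Hs_anti_trunc]
    by (simp add: case_prod_unfold w_def algebra_simps flip: Bochner_Integration.integral_diff)
  ultimately have 2: "?B w = 2 * ?B u"
    by simp
  have F: "integrable (lborel :: ('a \<times> 'a) measure) (\<lambda>(x, y). ?F x y)"
    by (rule in_Hs_integrable_bilinear[OF w_Hs in_Hs_anti_trunc])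
  have F_refl: "?F x (refl_hp e y) = ?F' x y" for x y
    by (simp add: w_anti \<phi>_anti)
  have F': "integrable (lborel :: ('a \<times> 'a) measure) (\<lambda>(x, y). ?F' x y)"
    "integral\<^sup>L (lborel :: ('a \<times> 'a) measure) (\<lambda>(x, y). ?F' x y) = ?B w"
    using integrable_energy_refl_hp(1,2)[OF e, of ?F] F unfolding F_refl by simp_all
  have FF': "integrable (lborel :: ('a \<times> 'a) measure) (\<lambda>(x, y). - (?F x y + ?F' x y))"
    "integral\<^sup>L (lborel :: ('a \<times> 'a) measure) (\<lambda>(x, y). - (?F x y + ?F' x y)) = - 4 * ?B u"
    using F F' 2 by (simp_all add: case_prod_unfold)
  have G0: "0 \<le> ?G x y" for x y
    by (auto simp: anti_trunc_def)
  have G_le: "?G x y \<le> - (?F x y + ?F' x y)" for x y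
    using anti_trunc_energy_le[where w = w, OF e \<epsilon> q w_anti, of x y] by linarith
  have "(\<integral>\<^sup>+x. \<integral>\<^sup>+y. ennreal (?G x y) \<partial>lborel \<partial>lborel)
      \<le> (\<integral>\<^sup>+x. \<integral>\<^sup>+y. ennreal (- (?F x y + ?F' x y)) \<partial>lborel \<partial>lborel)"
    by (intro nn_integral_mono ennreal_leI G_le)
  also have "\<dots> = (\<integral>\<^sup>+p. ennreal (case p of (x, y) \<Rightarrow> - (?F x y + ?F' x y)) \<partial>(lborel \<Otimes>\<^sub>M lborel))"
    by (subst lborel.nn_integral_fst[symmetric]) simp_all
  also have "\<dots> = ennreal (- 4 * ?B u)"
    unfolding lborel_prod FF'(2)[symmetric]
    using order_trans[OF G0 G_le] by (intro nn_integral_eq_integral FF'(1)) auto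
  finally show ?thesis .
qed

end

section \<open>Lower bounds for the kernel\<close>

text \<open>It suffices to integrate over the ball around \<open>x\<close> of radius
  \<open>x \<bullet> e\<close>: it lies in the half space, and the mirror images of its points are
  within distance \<open>3 * (x \<bullet> e)\<close> of \<open>x\<close>.\<close>

lemma nn_integral_kern_refl_hp_ge:
  fixes x :: "'a::euclidean_space"
  assumes e: "norm e = 1" and q: "0 \<le> q" and x: "0 < x \<bullet> e"
  shows "ennreal (unit_ball_vol DIM('a) * (x \<bullet> e) ^ DIM('a) / (3 * (x \<bullet> e)) powr q)
    \<le> (\<integral>\<^sup>+y. ennreal (if y \<bullet> e > 0 then kern q (x - refl_hp e y) else 0) \<partial>lborel)"
proof -
  let ?t = "x \<bullet> e"
  have "ennreal (1 / (3 * ?t) powr q) * indicator (ball x ?t) y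
      \<le> ennreal (if y \<bullet> e > 0 then kern q (x - refl_hp e y) else 0)" for y
  proof (cases "y \<in> ball x ?t")
    case True
    have "\<bar>(x - y) \<bullet> e\<bar> \<le> norm (x - y)"
      using Cauchy_Schwarz_ineq2[of "x - y" e] e by simp
    with True have y: "0 < y \<bullet> e"
      by (simp add: dist_norm inner_diff_left)
    have "x - refl_hp e y = (x - refl_hp e x) + refl_hp e (x - y)"
      by (simp flip: refl_hp_diff)
    then have "norm (x - refl_hp e y) \<le> norm (x - refl_hp e x) + norm (x - y)"
      by (metis norm_triangle_ineq norm_refl_hp[OF e])
    also have "norm (x - refl_hp e x) = 2 * ?t"
      using x e by (simp add: refl_hp_def)
    finally have le: "norm (x - refl_hp e y) \<le> 3 * ?t"
      using True by (simp add: dist_norm)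
    have "x \<noteq> refl_hp e y"
      using x y refl_hp_inner[OF e, of y] by auto
    then have "1 / (3 * ?t) powr q \<le> kern q (x - refl_hp e y)"
      unfolding kern_def using le q x by (intro divide_left_mono powr_mono2 mult_pos_pos) auto
    with True y show ?thesis
      by (auto intro: ennreal_leI)
  qed simp
  then have "(\<integral>\<^sup>+y. ennreal (1 / (3 * ?t) powr q) * indicator (ball x ?t) y \<partial>lborel)
     \<le> (\<integral>\<^sup>+y. ennreal (if y \<bullet> e > 0 then kern q (x - refl_hp e y) else 0) \<partial>lborel)"
    by (rule nn_integral_mono)
  moreover have "(\<integral>\<^sup>+y. ennreal (1 / (3 * ?t) powr q) * indicator (ball x ?t) y \<partial>lborel)
    = ennreal (unit_ball_vol DIM('a) * (x \<bullet> e) ^ DIM('a) / (3 * (x \<bullet> e)) powr q)"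
    using x by (subst nn_integral_cmult_indicator) (simp_all add: emeasure_ball mult.commute flip: ennreal_mult)
  ultimately show ?thesis by simp
qed

lemma nn_integral_kern_refl_hp_large:
  fixes \<Lambda> s :: real
  assumes s: "0 < s"
  obtains d where "0 < d"
    "\<And>(e::'a::euclidean_space) x. norm e = 1 \<Longrightarrow> 0 < x \<bullet> e \<Longrightarrow> x \<bullet> e < d \<Longrightarrow>
      ennreal \<Lambda> \<le> (\<integral>\<^sup>+y. ennreal (if y \<bullet> e > 0 then kern (real DIM('a) + 2 * s) (x - refl_hp e y) else 0) \<partial>lborel)"
proof -
  define C where "C = unit_ball_vol DIM('a) / 3 powr (real DIM('a) + 2 * s)"
  define M where "M = max 1 \<Lambda>"
  \<comment> \<open>In the lower bound the powers of order \<open>DIM('a)\<close> cancel, leaving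
    \<open>C / t powr (2 * s)\<close> with \<open>t = x \<bullet> e\<close>; this equals
    \<open>M\<close> exactly at \<open>t = d\<close>.\<close>
  define d where "d = (C / M) powr (1 / (2 * s))"
  have C: "0 < C" and M: "0 < M" "\<Lambda> \<le> M"
    by (simp_all add: C_def M_def)
  then have d: "0 < d"
    by (simp add: d_def)
  show thesis
  proof (rule that[OF d])
    fix e x :: 'a assume e: "norm e = 1" and x: "0 < x \<bullet> e" "x \<bullet> e < d"
    let ?t = "x \<bullet> e"
    have "?t powr (2 * s) \<le> d powr (2 * s)"
      using x s by (intro powr_mono2) auto
    also have "d powr (2 * s) = C / M"
      using s C M by (simp add: d_def powr_powr)
    finally have "M \<le> C / ?t powr (2 * s)"
      using x M by (simp add: field_simps)
    with M have "\<Lambda> \<le> C / ?t powr (2 * s)"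
      by simp
    also have "\<dots> = unit_ball_vol DIM('a) * ?t ^ DIM('a) / (3 * ?t) powr (real DIM('a) + 2 * s)"
      using x by (simp add: C_def powr_mult powr_add powr_realpow field_simps)
    finally have "ennreal \<Lambda> \<le> ennreal (unit_ball_vol DIM('a) * ?t ^ DIM('a) / (3 * ?t) powr (real DIM('a) + 2 * s))"
      by (rule ennreal_leI)
    also have "\<dots> \<le> (\<integral>\<^sup>+y. ennreal (if y \<bullet> e > 0 then kern (real DIM('a) + 2 * s) (x - refl_hp e y) else 0) \<partial>lborel)"
      using s by (intro nn_integral_kern_refl_hp_ge e x) auto
    finally show "ennreal \<Lambda> \<le> (\<integral>\<^sup>+y. ennreal (if y \<bullet> e > 0 then kern (real DIM('a) + 2 * s) (x - refl_hp e y) else 0) \<partial>lborel)" .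
  qed
qed

text \<open>The ratio of the distances of \<open>x\<close> to \<open>y\<close> and to its mirror
  image is at most \<open>R / sqrt (R\<^sup>2 + c)\<close>, which is below 1, while
  \<open>kern q (x - y)\<close> is at least \<open>1 / R powr q\<close>. The constant must not
  depend on \<open>e\<close>, because the direction varies later.\<close>

lemma kern_diff_ge:
  fixes R c q :: real
  assumes "0 < R" "0 < c" "0 < q"
  obtains m where "0 < m"
    "\<And>(e::'a::euclidean_space) x y. norm e = 1 \<Longrightarrow> x \<noteq> y \<Longrightarrow> norm (x - y) \<le> R \<Longrightarrow>
      c \<le> 4 * (x \<bullet> e) * (y \<bullet> e) \<Longrightarrow> m \<le> kern q (x - y) - kern q (x - refl_hp e y)"
proof -
  define \<rho> where "\<rho> = R / sqrt (R\<^sup>2 + c)"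
  define m where "m = (1 - \<rho> powr q) / R powr q"
  have R: "R < sqrt (R\<^sup>2 + c)"
    using assms by (intro real_less_rsqrt) simp
  with assms have "0 < sqrt (R\<^sup>2 + c)"
    by linarith
  with R assms have \<rho>: "0 < \<rho>" "\<rho> < 1"
    unfolding \<rho>_def by (simp_all only: divide_pos_pos divide_less_eq_1_pos)
  then have \<rho>q: "\<rho> powr q < 1"
    using assms powr_less_mono2[of q \<rho> 1] by simp
  have m: "0 < m"
    using \<rho>q assms by (simp add: m_def)
  show thesis
  proof (rule that[OF m])
    fix e x y :: 'a
    assume e: "norm e = 1" and ne: "x \<noteq> y" and R: "norm (x - y) \<le> R"
      and c: "c \<le> 4 * (x \<bullet> e) * (y \<bullet> e)"
    let ?r = "norm (x - y)" and ?r' = "norm (x - refl_hp e y)"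
    have r: "0 < ?r" using ne by simp
    have sq: "?r\<^sup>2 + c \<le> ?r'\<^sup>2"
      using c by (simp add: norm_diff_refl_hp_sq[OF e])
    have "0 < ?r'\<^sup>2"
      using sq r assms by (smt (verit) zero_less_power)
    then have r': "0 < ?r'"
      by simp
    have "?r\<^sup>2 * (R\<^sup>2 + c) \<le> R\<^sup>2 * ?r'\<^sup>2"
    proof -
      have "?r\<^sup>2 * c \<le> R\<^sup>2 * c"
        using R assms by (intro mult_right_mono power_mono) auto
      moreover have "R\<^sup>2 * (?r\<^sup>2 + c) \<le> R\<^sup>2 * ?r'\<^sup>2"
        using sq by (intro mult_left_mono) auto
      ultimately show ?thesis by (simp add: algebra_simps)
    qed
    then have "sqrt (?r\<^sup>2 * (R\<^sup>2 + c)) \<le> sqrt (R\<^sup>2 * ?r'\<^sup>2)"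
      by (rule real_sqrt_le_mono)
    then have "?r * sqrt (R\<^sup>2 + c) \<le> R * ?r'"
      using assms by (simp add: real_sqrt_mult)
    moreover have "0 < sqrt (R\<^sup>2 + c)"
      using assms by (simp add: add_pos_pos)
    ultimately have "?r / ?r' \<le> \<rho>"
      using r' by (simp add: \<rho>_def field_simps)
    then have "(?r / ?r') powr q \<le> \<rho> powr q"
      using r r' assms by (intro powr_mono2) auto
    then have "kern q (x - refl_hp e y) \<le> kern q (x - y) * \<rho> powr q"
      using r r' by (simp add: kern_def powr_divide field_simps)
    moreover have "m \<le> kern q (x - y) * (1 - \<rho> powr q)"
    proof -
      have "1 / R powr q \<le> kern q (x - y)"
        unfolding kern_def using r R assms by (intro divide_left_mono powr_mono2 mult_pos_pos) auto
      from mult_right_mono[OF this, of "1 - \<rho> powr q"] \<rho>q show ?thesis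
        by (simp add: m_def)
    qed
    ultimately show "m \<le> kern q (x - y) - kern q (x - refl_hp e y)"
      by (simp add: algebra_simps)
  qed
qed

section \<open>The equation tested with the truncation\<close>

lemma c_Ns_pos: "0 < s \<Longrightarrow> s < 1 \<Longrightarrow> 0 < c_Ns N s"
  unfolding c_Ns_def by (intro divide_pos_pos mult_pos_pos Gamma_real_pos add_nonneg_pos) auto

lemma refl_hp_mem_radial_set: "radial_set \<Omega> \<Longrightarrow> norm e = 1 \<Longrightarrow> refl_hp e x \<in> \<Omega> \<longleftrightarrow> x \<in> \<Omega>"
  by (metis radial_set_def norm_refl_hp)

text \<open>The Lipschitz bound is demanded at values of \<open>u\<close> only: in the theorem
  \<open>u\<close> is bounded, so a single constant of the locally Lipschitz nonlinearity
  serves.\<close>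

locale fractional_problem =
  fixes \<Omega> :: "'a::euclidean_space set" and s :: real and f :: "real \<Rightarrow> real \<Rightarrow> real" and u :: "'a \<Rightarrow> real"
    and L :: real
  assumes bounded_domain: "bounded \<Omega>" and radial: "radial_set \<Omega>"
    and s: "0 < s" "s < 1"
    and L: "0 \<le> L" and lip: "\<And>r x y. 0 \<le> r \<Longrightarrow> \<bar>f r (u x) - f r (u y)\<bar> \<le> L * \<bar>u x - u y\<bar>"
    and u_cont: "continuous_on UNIV u"
    and weak: "weak_solution s \<Omega> f u"
begin

lemma u_outside: "x \<notin> \<Omega> \<Longrightarrow> u x = 0"
  using weak by (simp add: weak_solution_def in_Hs0_def)

lemma u_in_Hs: "in_Hs s u"
  using weak by (simp add: weak_solution_def in_Hs0_def)

lemma u_meas [measurable]: "u \<in> borel_measurable borel"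
  by (rule borel_measurable_continuous_onI[OF u_cont])

definition refl_diff :: "'a \<Rightarrow> 'a \<Rightarrow> real" where
  "refl_diff e x = u x - u (refl_hp e x)"

lemma refl_diff_refl: "norm e = 1 \<Longrightarrow> refl_diff e (refl_hp e x) = - refl_diff e x"
  by (simp add: refl_diff_def refl_hp_involutive)

lemma refl_diff_outside: "norm e = 1 \<Longrightarrow> x \<notin> \<Omega> \<Longrightarrow> refl_diff e x = 0"
  by (simp add: refl_diff_def u_outside refl_hp_mem_radial_set[OF radial])

lemma refl_diff_0: "x \<bullet> e = 0 \<Longrightarrow> refl_diff e x = 0"
  by (simp add: refl_diff_def refl_hp_def)

lemma continuous_on_refl_diff [continuous_intros]:
  "continuous_on S g \<Longrightarrow> continuous_on S h \<Longrightarrow> continuous_on S (\<lambda>z. refl_diff (g z) (h z))"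
  unfolding refl_diff_def
  by (intro continuous_intros continuous_on_compose2[OF u_cont]) auto

lemma refl_diff_meas [measurable]: "refl_diff e \<in> borel_measurable borel"
  by (intro borel_measurable_continuous_onI continuous_intros)

text \<open>Makes the truncation an admissible test function: its support lies in the closed set
  where \<open>\<bar>refl_diff e x\<bar> \<ge> \<epsilon>\<close>, and \<open>refl_diff e\<close>
  vanishes outside the domain.\<close>

lemma in_Hs0_anti_trunc_refl_diff:
  assumes e: "norm e = 1" and \<epsilon>: "0 < \<epsilon>"
  defines "\<phi> \<equiv> anti_trunc e \<epsilon> (refl_diff e)"
  shows "in_Hs0 s \<Omega> \<phi>" "compact (closure {x. \<phi> x \<noteq> 0})" "closure {x. \<phi> x \<noteq> 0} \<subseteq> \<Omega>"
proof -
  have "in_Hs s \<phi>"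
    unfolding \<phi>_def using \<epsilon> by (intro in_Hs_anti_trunc[OF e _ s(1) u_in_Hs]) (auto simp: refl_diff_def)
  moreover have "\<phi> x = 0" if "x \<notin> \<Omega>" for x
    using abs_anti_trunc_le[of \<epsilon> e "refl_diff e" x] \<epsilon> refl_diff_outside[OF e that] by (simp add: \<phi>_def)
  ultimately show "in_Hs0 s \<Omega> \<phi>"
    by (auto simp: in_Hs0_def)
  have "closed {x. \<epsilon> \<le> \<bar>refl_diff e x\<bar>}"
    by (intro closed_Collect_le continuous_intros)
  moreover have "{x. \<phi> x \<noteq> 0} \<subseteq> {x. \<epsilon> \<le> \<bar>refl_diff e x\<bar>}"
    using anti_trunc_nonzero[of \<epsilon> e "refl_diff e"] \<epsilon> by (auto simp: \<phi>_def)
  ultimately have "closure {x. \<phi> x \<noteq> 0} \<subseteq> {x. \<epsilon> \<le> \<bar>refl_diff e x\<bar>}"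
    by (intro closure_minimal)
  also have "\<dots> \<subseteq> \<Omega>"
    using refl_diff_outside[OF e] \<epsilon> by fastforce
  finally show sub: "closure {x. \<phi> x \<noteq> 0} \<subseteq> \<Omega>" .
  then show "compact (closure {x. \<phi> x \<noteq> 0})"
    using bounded_subset[OF bounded_domain] by (auto simp: compact_eq_bounded_closed)
qed

text \<open>Testing with the odd function \<open>\<phi>\<close> and adding the reflected integrand
  turns the right-hand side into a difference of \<open>f\<close> at \<open>u x\<close> and
  \<open>u (refl_hp e x)\<close> with the same radius, where the Lipschitz bound applies. The
  constant combines the factor 4 of the energy bound with \<open>c_Ns DIM('a) s / 2\<close> from the
  equation.\<close>

lemma energy_refl_diff_le:
  assumes e: "norm e = 1" and \<epsilon>: "0 < \<epsilon>"
  defines "w \<equiv> refl_diff e" and "\<phi> \<equiv> anti_trunc e \<epsilon> (refl_diff e)"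
    and "k \<equiv> kern (real DIM('a) + 2 * s) :: 'a \<Rightarrow> real"
    and "g \<equiv> \<lambda>x. if x \<bullet> e > 0 then anti_trunc e \<epsilon> (refl_diff e) x * \<bar>refl_diff e x\<bar> else 0"
  shows "integrable lborel g"
    and "(\<integral>\<^sup>+x. \<integral>\<^sup>+y. ennreal (if x \<bullet> e > 0 \<and> y \<bullet> e > 0 then \<phi> x *
         (max 0 (k (x - y) - k (x - refl_hp e y)) * max 0 (w y)
          + 2 * k (x - refl_hp e y) * \<bar>w x\<bar>) else 0) \<partial>lborel \<partial>lborel)
     \<le> ennreal (8 * L / c_Ns DIM('a) s * integral\<^sup>L lborel g)"
proof -
  let ?B = "integral\<^sup>L (lborel :: ('a \<times> 'a) measure)
       (\<lambda>(x, y). (u x - u y) * (\<phi> x - \<phi> y) * k (x - y))"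
  define h where "h = (\<lambda>x. indicator \<Omega> x * (f (norm x) (u x) * \<phi> x))"
  have w_refl: "w (refl_hp e x) = - w x" for x
    using refl_diff_refl[OF e] by (simp add: w_def)
  have \<phi>_refl: "\<phi> (refl_hp e x) = - \<phi> x" for x
    unfolding \<phi>_def by (rule anti_trunc_refl_hp[OF e]) (rule refl_diff_refl[OF e])
  have \<phi>_0: "\<phi> x = 0" if "x \<bullet> e = 0" for x
    using that by (simp add: \<phi>_def anti_trunc_def)
  have \<phi>_le: "\<bar>\<phi> x\<bar> \<le> \<bar>w x\<bar>" for x
    using \<epsilon> abs_anti_trunc_le[of \<epsilon> e "refl_diff e" x] by (simp add: w_def \<phi>_def)
  have [measurable]: "w \<in> borel_measurable borel" "\<phi> \<in> borel_measurable borel"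
    unfolding w_def \<phi>_def by measurable
  have g_eq: "g = (\<lambda>x. if x \<bullet> e > 0 then \<bar>w x * \<phi> x\<bar> else 0)"
    by (auto simp: g_def w_def \<phi>_def fun_eq_iff abs_mult anti_trunc_def)
  have "in_Hs s w"
    using in_Hs_diff[OF u_in_Hs in_Hs_refl_hp[OF e u_in_Hs]] by (simp add: w_def refl_diff_def[abs_def])
  then have w2: "integrable lborel (\<lambda>x. (w x)\<^sup>2)"
    by (simp add: in_Hs_def)
  have w\<phi>: "integrable lborel (\<lambda>x. \<bar>w x * \<phi> x\<bar>)"
  proof (rule Bochner_Integration.integrable_bound[OF w2])
    have "\<bar>w x * \<phi> x\<bar> \<le> (w x)\<^sup>2" for x
      using mult_left_mono[OF \<phi>_le[of x], of "\<bar>w x\<bar>"] by (simp add: abs_mult power2_eq_square)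
    then show "AE x in lborel. norm \<bar>w x * \<phi> x\<bar> \<le> norm ((w x)\<^sup>2)"
      by simp
  qed measurable
  show g: "integrable lborel g"
    by (rule Bochner_Integration.integrable_bound[OF w\<phi>]) (auto simp: g_eq)
  have g_refl: "integrable lborel (\<lambda>x. g (refl_hp e x))" "(\<integral>x. g (refl_hp e x) \<partial>lborel) = integral\<^sup>L lborel g"
    using integrable_involutive_isometry[of "refl_hp e" g] integral_involutive_isometry[of "refl_hp e" g] g
    by (simp_all add: dist_refl_hp refl_hp_involutive e)
  \<comment> \<open>\<open>g\<close> lives on one half space and its reflected copy on the other; on
    the hyperplane \<open>\<phi>\<close> vanishes.\<close>
  have "(\<integral>x. \<bar>w x * \<phi> x\<bar> \<partial>lborel) = (\<integral>x. g x + g (refl_hp e x) \<partial>lborel)"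
    by (intro Bochner_Integration.integral_cong)
      (use \<phi>_0 in \<open>force simp: g_eq refl_hp_inner[OF e] w_refl \<phi>_refl\<close>)+
  also have "\<dots> = 2 * integral\<^sup>L lborel g"
    using g g_refl by simp
  finally have w\<phi>_eq: "(\<integral>x. \<bar>w x * \<phi> x\<bar> \<partial>lborel) = 2 * integral\<^sup>L lborel g" .
  have h_bound: "\<bar>2 * integral\<^sup>L lborel h\<bar> \<le> L * (2 * integral\<^sup>L lborel g)"
  proof (cases "integrable lborel h")
    case True
    then have h_refl: "integrable lborel (\<lambda>x. h (refl_hp e x))" "(\<integral>x. h (refl_hp e x) \<partial>lborel) = integral\<^sup>L lborel h"
      using integrable_involutive_isometry[of "refl_hp e" h] integral_involutive_isometry[of "refl_hp e" h]
      by (simp_all add: dist_refl_hp refl_hp_involutive e)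
    have "\<bar>2 * integral\<^sup>L lborel h\<bar> = \<bar>\<integral>x. h x + h (refl_hp e x) \<partial>lborel\<bar>"
      using True h_refl by simp
    also have "\<dots> \<le> (\<integral>x. \<bar>h x + h (refl_hp e x)\<bar> \<partial>lborel)"
      by (rule integral_abs_bound)
    also have "\<dots> \<le> (\<integral>x. L * \<bar>w x * \<phi> x\<bar> \<partial>lborel)"
    proof (rule integral_mono)
      fix x
      have "h x + h (refl_hp e x) = indicator \<Omega> x * ((f (norm x) (u x) - f (norm x) (u (refl_hp e x))) * \<phi> x)"
        by (simp add: h_def \<phi>_refl norm_refl_hp[OF e] refl_hp_mem_radial_set[OF radial e] indicator_def algebra_simps)
      also have "\<bar>\<dots>\<bar> \<le> \<bar>(f (norm x) (u x) - f (norm x) (u (refl_hp e x))) * \<phi> x\<bar>"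
        by (simp add: indicator_def)
      also have "\<dots> \<le> L * \<bar>w x * \<phi> x\<bar>"
        using mult_right_mono[OF lip[of "norm x" x "refl_hp e x"], of "\<bar>\<phi> x\<bar>"]
        by (simp add: abs_mult w_def refl_diff_def mult.assoc)
      finally show "\<bar>h x + h (refl_hp e x)\<bar> \<le> L * \<bar>w x * \<phi> x\<bar>" .
    qed (use True h_refl w\<phi> in auto)
    finally show ?thesis
      using w\<phi>_eq by simp
  next
    \<comment> \<open>\<open>f\<close> need not be measurable in \<open>r\<close>; a non-integrable right-hand side has the junk value \<open>0\<close>.\<close>
    case False
    have "0 \<le> integral\<^sup>L lborel g"
      by (intro Bochner_Integration.integral_nonneg) (simp add: g_eq)
    with False L show ?thesis
      by (simp add: not_integrable_integral_eq)
  qed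
  have "c_Ns DIM('a) s / 2 * ?B = integral\<^sup>L lborel h"
    using weak in_Hs0_anti_trunc_refl_diff[OF e \<epsilon>]
    by (simp add: weak_solution_def set_lebesgue_integral_def \<phi>_def h_def k_def kern_def)
  moreover have c: "0 < c_Ns DIM('a) s"
    by (rule c_Ns_pos[OF s])
  ultimately have "?B = 2 / c_Ns DIM('a) s * integral\<^sup>L lborel h"
    by (simp add: field_simps)
  then have "- 4 * ?B = 4 / c_Ns DIM('a) s * (- (2 * integral\<^sup>L lborel h))"
    by simp
  also have "\<dots> \<le> 4 / c_Ns DIM('a) s * (L * (2 * integral\<^sup>L lborel g))"
    using c h_bound by (intro mult_left_mono) auto
  finally have B: "- 4 * ?B \<le> 8 * L / c_Ns DIM('a) s * integral\<^sup>L lborel g"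
    by simp
  have "w = (\<lambda>x. u x - u (refl_hp e x))"
    by (simp add: w_def refl_diff_def[abs_def])
  note energy = energy_anti_trunc[OF e less_imp_le[OF \<epsilon>] s(1) u_in_Hs this, folded k_def]
  show "(\<integral>\<^sup>+x. \<integral>\<^sup>+y. ennreal (if x \<bullet> e > 0 \<and> y \<bullet> e > 0 then \<phi> x *
         (max 0 (k (x - y) - k (x - refl_hp e y)) * max 0 (w y)
          + 2 * k (x - refl_hp e y) * \<bar>w x\<bar>) else 0) \<partial>lborel \<partial>lborel)
     \<le> ennreal (8 * L / c_Ns DIM('a) s * integral\<^sup>L lborel g)"
    using energy B[THEN ennreal_leI] unfolding \<phi>_def w_def by (rule order_trans)
qed

section \<open>Openness\<close>

text \<open>
  The first summand of the integral is the interaction with the positive part of \<open>w\<^sub>e\<close>, the second one that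
  with the reflected half space.
\<close>
lemma refl_diff_nonneg_of_absorption:
  fixes \<Lambda> :: real
  defines "k \<equiv> kern (real DIM('a) + 2 * s) :: 'a \<Rightarrow> real"
  assumes e: "norm e = 1" and \<Lambda>: "8 * L / c_Ns DIM('a) s < \<Lambda>"
    and absorb: "\<And>x. x \<bullet> e > 0 \<Longrightarrow> refl_diff e x < 0 \<Longrightarrow>
      ennreal (\<Lambda> * \<bar>refl_diff e x\<bar>) \<le> (\<integral>\<^sup>+y. ennreal (if y \<bullet> e > 0 then
         max 0 (k (x - y) - k (x - refl_hp e y)) * max 0 (refl_diff e y)
          + 2 * k (x - refl_hp e y) * \<bar>refl_diff e x\<bar> else 0) \<partial>lborel)"
    and x: "x \<bullet> e > 0"
  shows "0 \<le> refl_diff e x"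
proof (rule ccontr)
  assume neg: "\<not> 0 \<le> refl_diff e x"
  \<comment> \<open>Half the depth of the negative value, so that the truncation is still positive
    at \<open>x\<close>.\<close>
  define \<epsilon> where "\<epsilon> = - refl_diff e x / 2"
  have \<epsilon>: "0 < \<epsilon>" "refl_diff e x < - \<epsilon>"
    using neg by (auto simp: \<epsilon>_def)
  define \<phi> where "\<phi> = anti_trunc e \<epsilon> (refl_diff e)"
  define g where "g = (\<lambda>x. if x \<bullet> e > 0 then \<phi> x * \<bar>refl_diff e x\<bar> else 0)"
  define R where "R = (\<lambda>x y. if y \<bullet> e > 0 then
         max 0 (k (x - y) - k (x - refl_hp e y)) * max 0 (refl_diff e y)
          + 2 * k (x - refl_hp e y) * \<bar>refl_diff e x\<bar> else 0)"
  note energy = energy_refl_diff_le[OF e \<epsilon>(1), folded k_def \<phi>_def, folded g_def]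
  have \<phi>_nonneg: "0 \<le> \<phi> x" if "x \<bullet> e > 0" for x
    using that by (simp add: \<phi>_def anti_trunc_def)
  have g_nonneg: "0 \<le> g x" for x
    using \<phi>_nonneg by (simp add: g_def)
  have \<Lambda>0: "0 \<le> \<Lambda>"
    using \<Lambda> L c_Ns_pos[OF s, of "DIM('a)"] by (smt (verit) divide_nonneg_pos)
  have "ennreal (\<Lambda> * g x) \<le> (\<integral>\<^sup>+y. ennreal (if x \<bullet> e > 0 \<and> y \<bullet> e > 0 then \<phi> x *
         (max 0 (k (x - y) - k (x - refl_hp e y)) * max 0 (refl_diff e y)
          + 2 * k (x - refl_hp e y) * \<bar>refl_diff e x\<bar>) else 0) \<partial>lborel)" for x
  proof (cases "x \<bullet> e > 0 \<and> \<phi> x \<noteq> 0")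
    case True
    then have "0 < \<phi> x" "refl_diff e x < 0"
      using \<epsilon> by (auto simp: \<phi>_def anti_trunc_def max_def split: if_splits)
    with True have "ennreal (\<phi> x) * ennreal (\<Lambda> * \<bar>refl_diff e x\<bar>) \<le> ennreal (\<phi> x) * (\<integral>\<^sup>+y. ennreal (R x y) \<partial>lborel)"
      unfolding R_def by (intro mult_left_mono absorb) auto
    also have "\<dots> = (\<integral>\<^sup>+y. ennreal (\<phi> x) * ennreal (R x y) \<partial>lborel)"
      unfolding R_def k_def by (rule nn_integral_cmult[symmetric]) measurable
    also have "\<dots> = (\<integral>\<^sup>+y. ennreal (\<phi> x * R x y) \<partial>lborel)"
      using \<open>0 < \<phi> x\<close> by (simp add: ennreal_mult' less_imp_le)
    finally show ?thesis
      using True \<open>0 < \<phi> x\<close> \<Lambda>0 by (simp add: g_def R_def if_distrib mult.left_commute cong: if_cong flip: ennreal_mult)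
  qed (auto simp: g_def)
  then have "(\<integral>\<^sup>+x. ennreal (\<Lambda> * g x) \<partial>lborel) \<le> ennreal (8 * L / c_Ns DIM('a) s * integral\<^sup>L lborel g)"
    by (intro order_trans[OF nn_integral_mono energy(2)])
  moreover have "(\<integral>\<^sup>+x. ennreal (\<Lambda> * g x) \<partial>lborel) = ennreal (\<Lambda> * integral\<^sup>L lborel g)"
    using energy(1) g_nonneg \<Lambda>0 by (subst nn_integral_eq_integral) auto
  moreover have g_int: "0 \<le> integral\<^sup>L lborel g"
    using g_nonneg by (rule Bochner_Integration.integral_nonneg)
  moreover have "0 \<le> 8 * L / c_Ns DIM('a) s"
    using L c_Ns_pos[OF s, of "DIM('a)"] by simp
  ultimately have "\<Lambda> * integral\<^sup>L lborel g \<le> 8 * L / c_Ns DIM('a) s * integral\<^sup>L lborel g"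
    by (metis ennreal_le_iff mult_nonneg_nonneg)
  \<comment> \<open>The strict inequality between the two constants leaves no other nonnegative
    value.\<close>
  then have "integral\<^sup>L lborel g = 0"
    using \<Lambda> g_int by (metis mult_le_cancel_right not_less order_le_less)
  then have "AE x in lborel. g x = 0"
    using energy(1) g_nonneg by (subst (asm) integral_nonneg_eq_0_iff_AE) auto
  then have "AE x in lborel. x \<notin> {x. 0 < x \<bullet> e \<and> refl_diff e x < - \<epsilon>}" (is "AE x in lborel. x \<notin> ?S")
    by (rule eventually_mono) (use \<epsilon> in \<open>auto simp: g_def \<phi>_def anti_trunc_def max_def split: if_splits\<close>)
  \<comment> \<open>An open null set is empty, so the almost everywhere statement excludes the point
    \<open>x\<close> itself.\<close>
  moreover have "open ?S"
    by (intro open_Collect_conj open_Collect_less continuous_intros)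
  ultimately have "?S \<in> null_sets lborel"
    by (subst (asm) AE_iff_null) auto
  then have "negligible ?S"
    using negligible_iff_null_sets null_sets_completionI by blast
  with \<open>open ?S\<close> have "?S = {}"
    using open_not_negligible by blast
  with x \<epsilon> show False by blast
qed

text \<open>Compactness: violating points lie in the bounded domain, so they accumulate for
  directions tending to \<open>e0\<close>. By joint continuity the limit point violates
  nonnegativity for \<open>e0\<close>, also on the hyperplane, where \<open>refl_diff e0\<close> is
  0.\<close>

lemma refl_diff_lower_bound_near:
  assumes e0: "norm e0 = 1" and nonneg: "\<And>x. x \<bullet> e0 > 0 \<Longrightarrow> 0 \<le> refl_diff e0 x" and \<eta>: "0 < \<eta>"
  shows "\<forall>\<^sub>F e in at e0 within sphere 0 1. \<forall>x. x \<bullet> e > 0 \<longrightarrow> - \<eta> \<le> refl_diff e x"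
proof (rule ccontr)
  assume not: "\<not> ?thesis"
  have "\<exists>e. norm e = 1 \<and> dist e e0 < inverse (real (Suc n)) \<and> (\<exists>x. x \<bullet> e > 0 \<and> refl_diff e x < - \<eta>)" for n
  proof -
    have "\<not> (\<forall>e\<in>sphere 0 1. e \<noteq> e0 \<and> dist e e0 < inverse (real (Suc n)) \<longrightarrow>
        (\<forall>x. x \<bullet> e > 0 \<longrightarrow> - \<eta> \<le> refl_diff e x))"
      using not unfolding eventually_at by (meson inverse_Suc)
    then show ?thesis
      by (auto simp: not_le)
  qed
  then obtain E X where E: "\<And>n. norm (E n) = 1" "\<And>n. dist (E n) e0 < inverse (real (Suc n))"
    and X: "\<And>n. X n \<bullet> E n > 0" "\<And>n. refl_diff (E n) (X n) < - \<eta>"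
    by metis
  have "X n \<in> closure \<Omega>" for n
    using X(2)[of n] refl_diff_outside[OF E(1), of "X n" n] \<eta> closure_subset[of \<Omega>] by force
  moreover have "compact (closure \<Omega>)"
    using bounded_domain by simp
  ultimately obtain x r where x: "strict_mono r" "(X \<circ> r) \<longlonglongrightarrow> x"
    by (metis compact_def)
  have "(\<lambda>n. dist (E n) e0) \<longlonglongrightarrow> 0"
    by (rule Lim_null_comparison[OF _ LIMSEQ_inverse_real_of_nat])
      (use E(2) in \<open>auto intro!: always_eventually less_imp_le simp del: of_nat_Suc\<close>)
  then have "E \<longlonglongrightarrow> e0"
    by (simp only: tendsto_dist_iff[symmetric])
  then have Er: "(E \<circ> r) \<longlonglongrightarrow> e0"
    using x(1) by (rule LIMSEQ_subseq_LIMSEQ)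
  have "(\<lambda>n. refl_diff ((E \<circ> r) n) ((X \<circ> r) n)) \<longlonglongrightarrow> refl_diff e0 x"
  proof -
    have "continuous_on UNIV (\<lambda>p. refl_diff (fst p) (snd p))"
      by (intro continuous_intros)
    then show ?thesis
      using tendsto_Pair[OF Er x(2)] continuous_on_tendsto_compose[of UNIV "\<lambda>p. refl_diff (fst p) (snd p)"]
      by fastforce
  qed
  then have le: "refl_diff e0 x \<le> - \<eta>"
    using X(2) by (intro LIMSEQ_le_const2) (auto intro!: exI[of _ 0] less_imp_le)
  have "(\<lambda>n. (X \<circ> r) n \<bullet> (E \<circ> r) n) \<longlonglongrightarrow> x \<bullet> e0"
    by (intro tendsto_intros x Er)
  then have "0 \<le> x \<bullet> e0"
    using X(1) by (intro LIMSEQ_le_const) (auto intro!: exI[of _ 0] less_imp_le)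
  then have "0 \<le> refl_diff e0 x"
    using nonneg[of x] refl_diff_0[of x e0] by (cases "x \<bullet> e0 = 0") auto
  with le \<eta> show False by simp
qed

text \<open>All constants are fixed before \<open>e\<close> is chosen: \<open>d\<close> for the
  strip near the hyperplane, the ball around \<open>x0\<close>, and then \<open>m\<close> and
  \<open>\<alpha>\<close> for points outside the strip. Only afterwards is \<open>e\<close> taken
  close enough to \<open>e0\<close> for the negative values to be small relative to
  \<open>\<alpha>\<close>.\<close>

lemma eventually_refl_diff_nonneg:
  assumes e0: "norm e0 = 1" and nonneg: "\<And>x. x \<bullet> e0 > 0 \<Longrightarrow> 0 \<le> refl_diff e0 x"
    and x0: "x0 \<bullet> e0 > 0" "0 < refl_diff e0 x0"
  shows "\<forall>\<^sub>F e in at e0 within sphere 0 1.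
    (\<forall>x. x \<bullet> e > 0 \<longrightarrow> 0 \<le> refl_diff e x) \<and> (\<exists>x. x \<bullet> e > 0 \<and> 0 < refl_diff e x)"
proof -
  let ?k = "kern (real DIM('a) + 2 * s) :: 'a \<Rightarrow> real"
  define \<Lambda> where "\<Lambda> = 8 * L / c_Ns DIM('a) s + 1"
  define \<mu> where "\<mu> = refl_diff e0 x0 / 2"
  define d1 where "d1 = x0 \<bullet> e0 / 2"
  have "0 \<le> 8 * L / c_Ns DIM('a) s"
    using L c_Ns_pos[OF s, of "DIM('a)"] by simp
  then have \<Lambda>: "0 < \<Lambda>"
    by (simp add: \<Lambda>_def)
  obtain d where d: "0 < d" "\<And>(e::'a) x. norm e = 1 \<Longrightarrow> 0 < x \<bullet> e \<Longrightarrow> x \<bullet> e < d \<Longrightarrow>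
      ennreal \<Lambda> \<le> (\<integral>\<^sup>+y. ennreal (if y \<bullet> e > 0 then ?k (x - refl_hp e y) else 0) \<partial>lborel)"
    by (rule nn_integral_kern_refl_hp_large[OF s(1)]) blast
  \<comment> \<open>Openness jointly in direction and point gives one ball around \<open>x0\<close>
    that serves all \<open>e\<close> near \<open>e0\<close>.\<close>
  have "open {p. \<mu> < refl_diff (fst p) (snd p) \<and> d1 < snd p \<bullet> fst p}" (is "open ?S")
    by (intro open_Collect_conj open_Collect_less continuous_intros)
  moreover have "(e0, x0) \<in> ?S"
    using x0 by (simp add: \<mu>_def d1_def)
  ultimately obtain A B where AB: "open A" "open B" "e0 \<in> A" "x0 \<in> B" "A \<times> B \<subseteq> ?S"
    by (rule open_prod_elim) auto
  obtain \<rho>0 where "0 < \<rho>0" "ball x0 \<rho>0 \<subseteq> B"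
    using AB openE by blast
  then obtain \<rho> where \<rho>: "0 < \<rho>" "\<rho> \<le> 1" "ball x0 \<rho> \<subseteq> B"
    by (metis min.cobounded1 min.cobounded2 min_less_iff_conj subset_ball subset_trans zero_less_one)
  obtain b where b: "0 < b" "\<And>x. x \<in> \<Omega> \<Longrightarrow> norm x \<le> b"
    using bounded_domain by (auto simp: bounded_pos)
  \<comment> \<open>Bounds the distance from any point of the domain to any point of the ball, whose
    radius is at most 1.\<close>
  define R where "R = b + norm x0 + 1"
  have pos: "0 < R" "0 < 4 * d * d1" "0 < real DIM('a) + 2 * s" "0 < \<mu>" "0 < d1"
    using b d s x0 by (auto simp: R_def d1_def \<mu>_def add_pos_nonneg intro: add_nonneg_pos)
  obtain m where m: "0 < m"
    "\<And>(e::'a) x y. norm e = 1 \<Longrightarrow> x \<noteq> y \<Longrightarrow> norm (x - y) \<le> R \<Longrightarrow>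
      4 * d * d1 \<le> 4 * (x \<bullet> e) * (y \<bullet> e) \<Longrightarrow> m \<le> ?k (x - y) - ?k (x - refl_hp e y)"
    by (rule kern_diff_ge[OF pos(1-3)]) blast
  \<comment> \<open>A lower bound for the interaction with the ball: kernel gap times value of
    \<open>refl_diff e\<close> times volume. Negative values of size at most
    \<open>\<alpha> / \<Lambda>\<close> are absorbed by it.\<close>
  define \<alpha> where "\<alpha> = m * \<mu> * (unit_ball_vol DIM('a) * \<rho> ^ DIM('a))"
  have \<alpha>: "0 < \<alpha>"
    using m pos \<rho> by (simp add: \<alpha>_def)
  have "\<forall>\<^sub>F e in at e0 within sphere 0 1. \<forall>x. x \<bullet> e > 0 \<longrightarrow> - (\<alpha> / \<Lambda>) \<le> refl_diff e x"
    using \<alpha> \<Lambda> by (intro refl_diff_lower_bound_near e0 nonneg) auto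
  moreover have "\<forall>\<^sub>F e in at e0 within sphere 0 1. e \<in> A \<and> norm e = 1"
    using AB(1,3) by (auto simp: eventually_at_topological)
  ultimately show ?thesis
  proof eventually_elim
    case (elim e)
    then have e: "norm e = 1" "e \<in> A"
      and lower: "\<And>x. x \<bullet> e > 0 \<Longrightarrow> - (\<alpha> / \<Lambda>) \<le> refl_diff e x"
      by auto
    have near: "\<mu> < refl_diff e y" "d1 < y \<bullet> e" if "y \<in> ball x0 \<rho>" for y
      using that AB(5) e(2) \<rho>(3) by fastforce+
    have "0 \<le> refl_diff e x" if "x \<bullet> e > 0" for x
    proof (rule refl_diff_nonneg_of_absorption[OF e(1) _ _ that])
      show "8 * L / c_Ns DIM('a) s < \<Lambda>"
        by (simp add: \<Lambda>_def)
      fix x assume x: "0 < x \<bullet> e" "refl_diff e x < 0"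
      let ?w = "\<bar>refl_diff e x\<bar>"
      let ?R = "\<lambda>y. if y \<bullet> e > 0 then max 0 (?k (x - y) - ?k (x - refl_hp e y)) * max 0 (refl_diff e y)
          + 2 * ?k (x - refl_hp e y) * ?w else 0"
      show "ennreal (\<Lambda> * ?w) \<le> (\<integral>\<^sup>+y. ennreal (?R y) \<partial>lborel)"
      proof (cases "x \<bullet> e < d")
        case True
        have "ennreal (\<Lambda> * ?w) = ennreal ?w * ennreal \<Lambda>"
          using \<Lambda> by (simp add: mult.commute flip: ennreal_mult)
        also have "\<dots> \<le> ennreal ?w * (\<integral>\<^sup>+y. ennreal (if y \<bullet> e > 0 then ?k (x - refl_hp e y) else 0) \<partial>lborel)"
          by (intro mult_left_mono d e x True) simp
        also have "\<dots> = (\<integral>\<^sup>+y. ennreal ?w * ennreal (if y \<bullet> e > 0 then ?k (x - refl_hp e y) else 0) \<partial>lborel)"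
          by (rule nn_integral_cmult[symmetric]) measurable
        also have "\<dots> \<le> (\<integral>\<^sup>+y. ennreal (?R y) \<partial>lborel)"
        proof (rule nn_integral_mono)
          fix y
          have "?w * ?k (x - refl_hp e y) \<le> max 0 (?k (x - y) - ?k (x - refl_hp e y)) * max 0 (refl_diff e y)
              + 2 * ?k (x - refl_hp e y) * ?w"
            using mult_nonneg_nonneg[of ?w "?k (x - refl_hp e y)"]
              mult_nonneg_nonneg[of "max 0 (?k (x - y) - ?k (x - refl_hp e y))" "max 0 (refl_diff e y)"]
            by (simp add: mult.commute)
          then show "ennreal ?w * ennreal (if y \<bullet> e > 0 then ?k (x - refl_hp e y) else 0) \<le> ennreal (?R y)"
            by (auto intro!: ennreal_leI simp flip: ennreal_mult)
        qed
        finally show ?thesis .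
      next
        case False
        have "x \<in> \<Omega>"
          using x refl_diff_outside[OF e(1), of x] by auto
        \<comment> \<open>Removing the single point \<open>x\<close> avoids the diagonal and costs
          no measure.\<close>
        have "ennreal (m * \<mu>) * indicator (ball x0 \<rho> - {x}) y \<le> ennreal (?R y)" for y
        proof (cases "y \<in> ball x0 \<rho> - {x}")
          case True
          then have y: "y \<noteq> x" "\<mu> < refl_diff e y" "d1 < y \<bullet> e"
            using near by auto
          have "norm (x - y) \<le> norm x + norm x0 + dist x0 y"
            using norm_triangle_ineq4[of x y] norm_triangle_ineq2[of y x0]
            by (simp add: dist_norm norm_minus_commute)
          also have "\<dots> \<le> R"
            using b(2)[OF \<open>x \<in> \<Omega>\<close>] True \<rho>(2) by (simp add: R_def)
          finally have "norm (x - y) \<le> R" .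
          moreover have "d * d1 \<le> (x \<bullet> e) * (y \<bullet> e)"
            using False y(3) d(1) pos(5) by (intro mult_mono) auto
          ultimately have "m \<le> ?k (x - y) - ?k (x - refl_hp e y)"
            using y(1) by (intro m e) auto
          then have "m * \<mu> \<le> max 0 (?k (x - y) - ?k (x - refl_hp e y)) * max 0 (refl_diff e y)"
            using y(2) m(1) pos(4) by (intro mult_mono) auto
          then have "m * \<mu> \<le> ?R y"
            using y(3) pos(5) by (simp add: add_increasing2)
          with True show ?thesis
            by (auto intro: ennreal_leI)
        qed simp
        then have "(\<integral>\<^sup>+y. ennreal (m * \<mu>) * indicator (ball x0 \<rho> - {x}) y \<partial>lborel)
            \<le> (\<integral>\<^sup>+y. ennreal (?R y) \<partial>lborel)"
          by (rule nn_integral_mono)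
        also have "(\<integral>\<^sup>+y. ennreal (m * \<mu>) * indicator (ball x0 \<rho> - {x}) y \<partial>lborel) = ennreal \<alpha>"
        proof -
          have "emeasure lborel (ball x0 \<rho> - {x}) = emeasure lborel (ball x0 \<rho>)"
            by (intro emeasure_Diff_null_set finite_imp_null_set_lborel) auto
          then show ?thesis
            using m(1) pos(4) \<rho>(1)
            by (subst nn_integral_cmult_indicator) (simp_all add: emeasure_ball \<alpha>_def flip: ennreal_mult)
        qed
        finally have \<alpha>_le: "ennreal \<alpha> \<le> (\<integral>\<^sup>+y. ennreal (?R y) \<partial>lborel)" .
        have "\<Lambda> * ?w \<le> \<alpha>"
          using lower[OF x(1)] x(2) \<Lambda> by (simp add: field_simps)
        then have "ennreal (\<Lambda> * ?w) \<le> ennreal \<alpha>"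
          by (rule ennreal_leI)
        then show ?thesis
          using \<alpha>_le by (rule order_trans)
      qed
    qed
    moreover have "x0 \<bullet> e > 0" "0 < refl_diff e x0"
      using near[of x0] \<rho>(1) pos(4,5) by auto
    ultimately show ?case by blast
  qed
qed

section \<open>Foliated Schwarz symmetry\<close>

text \<open>Its direction will be the axis of symmetry.\<close>

definition moment :: 'a where
  "moment = (\<integral>x. u x *\<^sub>R x \<partial>lborel)"

lemma integrable_moment: "integrable lborel (\<lambda>x. u x *\<^sub>R x)"
proof -
  have "integrable lborel (\<lambda>x. indicator (closure \<Omega>) x *\<^sub>R (u x *\<^sub>R x))"
    using bounded_domain
    by (intro borel_integrable_compact continuous_intros continuous_on_subset[OF u_cont]) auto
  also have "(\<lambda>x. indicator (closure \<Omega>) x *\<^sub>R (u x *\<^sub>R x)) = (\<lambda>x. u x *\<^sub>R x)"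
    using u_outside closure_subset[of \<Omega>] by (auto simp: fun_eq_iff indicator_def)
  finally show ?thesis .
qed

text \<open>Reflecting the integration variable changes the sign of \<open>x \<bullet> e\<close>, so
  the reflected copy of \<open>u\<close> contributes \<open>moment \<bullet> e\<close> a second
  time.\<close>

lemma
  assumes e: "norm e = 1"
  shows integrable_refl_diff_moment: "integrable lborel (\<lambda>x. refl_diff e x * (x \<bullet> e))"
    and two_moment_inner: "2 * (moment \<bullet> e) = (\<integral>x. refl_diff e x * (x \<bullet> e) \<partial>lborel)"
proof -
  have I: "integrable lborel (\<lambda>x. u x * (x \<bullet> e))"
    using integrable_inner_left[OF integrable_moment, of e] by simp
  have m: "moment \<bullet> e = (\<integral>x. u x * (x \<bullet> e) \<partial>lborel)"
    using integral_inner_left[OF integrable_moment, of e] by (simp add: moment_def)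
  have I': "integrable lborel (\<lambda>x. - (u (refl_hp e x) * (x \<bullet> e)))"
    "(\<integral>x. - (u (refl_hp e x) * (x \<bullet> e)) \<partial>lborel) = moment \<bullet> e"
    using integrable_involutive_isometry[of "refl_hp e" "\<lambda>x. u x * (x \<bullet> e)"]
      integral_involutive_isometry[of "refl_hp e" "\<lambda>x. u x * (x \<bullet> e)"] I m
    by (simp_all add: dist_refl_hp refl_hp_involutive refl_hp_inner e)
  have eq: "(\<lambda>x. refl_diff e x * (x \<bullet> e)) = (\<lambda>x. u x * (x \<bullet> e) + - (u (refl_hp e x) * (x \<bullet> e)))"
    by (simp add: refl_diff_def fun_eq_iff algebra_simps)
  show "integrable lborel (\<lambda>x. refl_diff e x * (x \<bullet> e))"
    unfolding eq by (rule Bochner_Integration.integrable_add[OF I I'(1)])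
  show "2 * (moment \<bullet> e) = (\<integral>x. refl_diff e x * (x \<bullet> e) \<partial>lborel)"
    unfolding eq Bochner_Integration.integral_add[OF I I'(1)] I'(2) m by simp
qed

text \<open>Both factors of the integrand are odd under the reflection, so it is nonnegative on the
  whole space, and by continuity it is positive on a nonempty open set.\<close>

lemma moment_inner_pos:
  assumes e: "norm e = 1" and nonneg: "\<And>x. x \<bullet> e > 0 \<Longrightarrow> 0 \<le> refl_diff e x"
    and x0: "x0 \<bullet> e > 0" "0 < refl_diff e x0"
  shows "0 < moment \<bullet> e"
proof -
  have ge: "0 \<le> refl_diff e x * (x \<bullet> e)" for x
  proof (cases "x \<bullet> e < 0")
    case True
    then have "refl_diff e x \<le> 0"
      using nonneg[of "refl_hp e x"] by (simp add: refl_hp_inner e refl_diff_refl)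
    with True show ?thesis by (simp add: mult_nonpos_nonpos)
  qed (use nonneg[of x] in \<open>cases "x \<bullet> e = 0"; simp\<close>)
  have "(\<integral>x. refl_diff e x * (x \<bullet> e) \<partial>lborel) \<noteq> 0"
  proof
    assume "(\<integral>x. refl_diff e x * (x \<bullet> e) \<partial>lborel) = 0"
    then have "AE x in lborel. refl_diff e x * (x \<bullet> e) = 0"
      using integrable_refl_diff_moment[OF e] ge by (subst (asm) integral_nonneg_eq_0_iff_AE) auto
    then have "AE x in lborel. x \<notin> {x. 0 < refl_diff e x * (x \<bullet> e)}" (is "AE x in lborel. x \<notin> ?S")
      by (rule eventually_mono) auto
    moreover have "open ?S"
      by (intro open_Collect_less continuous_intros)
    ultimately have "?S \<in> null_sets lborel"
      by (subst (asm) AE_iff_null) auto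
    then have "negligible ?S"
      using negligible_iff_null_sets null_sets_completionI by blast
    with \<open>open ?S\<close> have "?S = {}"
      using open_not_negligible by blast
    moreover have "x0 \<in> ?S"
      using x0 by simp
    ultimately show False by blast
  qed
  moreover have "0 \<le> (\<integral>x. refl_diff e x * (x \<bullet> e) \<partial>lborel)"
    using ge by (rule Bochner_Integration.integral_nonneg)
  ultimately show ?thesis
    using two_moment_inner[OF e] by simp
qed

text \<open>Rules out, inside the open hemisphere, limits of admissible directions for which
  \<open>refl_diff e\<close> degenerates to 0.\<close>

lemma moment_inner_0:
  assumes e: "norm e = 1" and zero: "\<And>x. x \<bullet> e > 0 \<Longrightarrow> refl_diff e x = 0"
  shows "moment \<bullet> e = 0"
proof -
  have "refl_diff e x * (x \<bullet> e) = 0" for x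
    using zero[of x] zero[of "refl_hp e x"] e
    by (cases "x \<bullet> e" "0::real" rule: linorder_cases) (auto simp: refl_hp_inner refl_diff_refl)
  then have "(\<lambda>x. refl_diff e x * (x \<bullet> e)) = (\<lambda>x. 0)"
    by (rule ext)
  from two_moment_inner[OF e, unfolded this] show ?thesis
    by simp
qed

lemma refl_diff_nonneg_limit:
  assumes E: "E \<longlonglongrightarrow> e" and nonneg: "\<And>n x. x \<bullet> E n > 0 \<Longrightarrow> 0 \<le> refl_diff (E n) x"
    and x: "x \<bullet> e > 0"
  shows "0 \<le> refl_diff e x"
proof (rule tendsto_lowerbound)
  have "continuous_on UNIV (\<lambda>e. refl_diff e x)"
    by (intro continuous_intros)
  then show "(\<lambda>n. refl_diff (E n) x) \<longlonglongrightarrow> refl_diff e x"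
    using E continuous_on_tendsto_compose[of UNIV "\<lambda>e. refl_diff e x" E e] by simp
  have "(\<lambda>n. x \<bullet> E n) \<longlonglongrightarrow> x \<bullet> e"
    by (intro tendsto_intros E)
  then have "\<forall>\<^sub>F n in sequentially. x \<bullet> E n > 0"
    using x by (rule order_tendstoD)
  then show "\<forall>\<^sub>F n in sequentially. 0 \<le> refl_diff (E n) x"
    by (rule eventually_mono) (rule nonneg)
qed simp

lemma refl_diff_nonneg_hemisphere:
  assumes e1: "norm e1 = 1" "\<And>x. x \<bullet> e1 > 0 \<Longrightarrow> 0 \<le> refl_diff e1 x"
    and x1: "x1 \<bullet> e1 > 0" "0 < refl_diff e1 x1"
    and e: "norm e = 1" "0 < moment \<bullet> e" and x: "x \<bullet> e > 0"
  shows "0 \<le> refl_diff e x"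
proof -
  let ?H = "{e. norm e = 1 \<and> 0 < moment \<bullet> e}"
  define P where "P = {e. norm e = 1 \<and> (\<forall>x. x \<bullet> e > 0 \<longrightarrow> 0 \<le> refl_diff e x) \<and> (\<exists>x. x \<bullet> e > 0 \<and> 0 < refl_diff e x)}"
  have PH: "P \<subseteq> ?H"
    using moment_inner_pos by (auto simp: P_def)
  \<comment> \<open>The open hemisphere is the continuous image of a convex half space under
    normalization.\<close>
  have "connected ((\<lambda>v. v /\<^sub>R norm v) ` {v. 0 < moment \<bullet> v})"
  proof (intro connected_continuous_image convex_connected)
    show "convex {v. 0 < moment \<bullet> v}"
      using convex_halfspace_gt[of 0 moment] by (simp add: inner_commute)
    show "continuous_on {v. 0 < moment \<bullet> v} (\<lambda>v. v /\<^sub>R norm v)"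
      by (intro continuous_intros) auto
  qed
  moreover have "(\<lambda>v. v /\<^sub>R norm v) ` {v. 0 < moment \<bullet> v} = ?H"
  proof safe
    fix v assume v: "0 < moment \<bullet> v"
    then have "v \<noteq> 0" by auto
    with v show "norm (v /\<^sub>R norm v) = 1" "0 < moment \<bullet> (v /\<^sub>R norm v)" by simp_all
  next
    fix e assume "norm e = 1" "0 < moment \<bullet> e"
    then show "e \<in> (\<lambda>v. v /\<^sub>R norm v) ` {v. 0 < moment \<bullet> v}"
      by (intro image_eqI[of _ _ e]) auto
  qed
  ultimately have "connected ?H" by simp
  moreover have "openin (top_of_set ?H) P"
    unfolding openin_contains_ball
  proof (intro conjI ballI PH)
    fix e assume "e \<in> P"
    then have "\<forall>\<^sub>F e in at e within sphere 0 1.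
      (\<forall>x. x \<bullet> e > 0 \<longrightarrow> 0 \<le> refl_diff e x) \<and> (\<exists>x. x \<bullet> e > 0 \<and> 0 < refl_diff e x)"
      using eventually_refl_diff_nonneg[of e] by (auto simp: P_def)
    then obtain d where "0 < d" "\<forall>e'\<in>sphere 0 1. e' \<noteq> e \<and> dist e' e < d \<longrightarrow> e' \<in> P"
      by (auto simp: eventually_at P_def)
    with \<open>e \<in> P\<close> show "\<exists>d>0. ball e d \<inter> ?H \<subseteq> P"
      by (intro exI[of _ d]) (auto simp: dist_commute)
  qed
  moreover have "e \<in> P" if eH: "e \<in> ?H" and eP: "e \<in> closure P" for e
  proof -
    have e: "norm e = 1" "0 < moment \<bullet> e"
      using eH by auto
    obtain E where E: "\<And>n. E n \<in> P" "E \<longlonglongrightarrow> e"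
      using eP unfolding closure_sequential by blast
    have nonneg: "0 \<le> refl_diff e x" if "x \<bullet> e > 0" for x
      using E by (intro refl_diff_nonneg_limit[OF E(2) _ that]) (auto simp: P_def)
    moreover have "\<exists>x. x \<bullet> e > 0 \<and> 0 < refl_diff e x"
    proof (rule ccontr)
      assume "\<not> ?thesis"
      with nonneg have "moment \<bullet> e = 0"
        by (intro moment_inner_0 e) (meson antisym not_less)
      with e show False by simp
    qed
    ultimately show "e \<in> P"
      using e by (simp add: P_def)
  qed
  then have "P = ?H \<inter> closure P"
    using PH closure_subset[of P] by blast
  then have "closedin (top_of_set ?H) P"
    unfolding closedin_closed by blast
  ultimately have "P = {} \<or> P = ?H"
    using connected_clopen by blast
  moreover have "e1 \<in> P"
    using e1 x1 by (auto simp: P_def)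
  ultimately have "e \<in> P"
    using e by blast
  with x show ?thesis
    by (simp add: P_def)
qed

end

section \<open>From reflection inequalities to geodesic balls\<close>

text \<open>For two points of one sphere around the origin the perpendicular bisector passes through
  the origin, so a reflection \<open>refl_hp\<close> exchanges them.\<close>

lemma refl_hp_normalized_diff:
  assumes "norm x = norm y" "x \<noteq> y"
  shows "refl_hp ((x - y) /\<^sub>R norm (x - y)) x = y" and "0 < x \<bullet> ((x - y) /\<^sub>R norm (x - y))"
proof -
  have "2 * (x \<bullet> (x - y)) = (norm (x - y))\<^sup>2"
    using assms(1) by (simp add: power2_norm_eq_inner norm_eq inner_diff_left inner_diff_right inner_commute)
  then have *: "x \<bullet> (x - y) = (norm (x - y))\<^sup>2 / 2"
    by simp
  have "0 < x \<bullet> (x - y)"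
    unfolding * using assms(2) by simp
  then show "0 < x \<bullet> ((x - y) /\<^sub>R norm (x - y))"
    using assms(2) by simp
  show "refl_hp ((x - y) /\<^sub>R norm (x - y)) x = y"
  proof -
    have "inverse (norm (x - y)) * (norm (x - y) * norm (x - y)) * inverse (norm (x - y)) = 1"
      using assms(2) by (simp add: divide_simps)
    then show ?thesis
      by (simp add: refl_hp_def * power2_eq_square)
  qed
qed

text \<open>A nonempty superlevel set on a sphere is compact, so \<open>x \<bullet> p\<close>
  attains its minimum there, at \<open>z\<close> say; by monotonicity the set is the closed cap
  bounded by the latitude of \<open>z\<close>. The full sphere is such a cap too, so the second
  disjunct always holds.\<close>

lemma foliated_schwarz_symmetricI:
  fixes u :: "'a::euclidean_space \<Rightarrow> real"
  assumes cont: "continuous_on UNIV u" and p: "norm p = 1"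
    and mono: "\<And>x y. norm x = norm y \<Longrightarrow> y \<bullet> p \<le> x \<bullet> p \<Longrightarrow> u y \<le> u x"
  shows "foliated_schwarz_symmetric \<Omega> u"
  unfolding foliated_schwarz_symmetric_def
proof (intro exI[of _ p] conjI p allI impI disjI2)
  fix r c :: real assume r: "0 < r"
  let ?T = "{x \<in> sphere 0 r. c \<le> u x}"
  have bound: "\<bar>x \<bullet> p / r\<bar> \<le> 1" if "x \<in> sphere 0 r" for x
    using that Cauchy_Schwarz_ineq2[of x p] p r by (simp add: field_simps)
  show "\<exists>\<rho>\<ge>0. geodesic_ball r p \<rho> ?T"
  proof (cases "?T = {}")
    case True
    have "0 \<le> arccos (x \<bullet> p / r)" if "x \<in> sphere 0 r" for x
      using bound[OF that] by (intro arccos_lbound) (simp_all only: abs_le_iff minus_le_iff)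
    \<comment> \<open>The empty set is the open ball of radius 0; a closed one would contain its
      centre.\<close>
    then have empty: "{x \<in> sphere 0 r. r * arccos ((x \<bullet> p) / r) < r * 0} = {}"
      using r by (auto simp: mult_less_0_iff not_less simp del: mem_sphere mem_sphere_0)
    have "geodesic_ball r p 0 ?T"
      unfolding geodesic_ball_def empty True by (rule disjI1) (rule refl)
    then show ?thesis by blast
  next
    case False
    have "?T = sphere 0 r \<inter> {x. c \<le> u x}" by auto
    moreover have "closed {x. c \<le> u x}"
      by (intro closed_Collect_le continuous_intros cont)
    ultimately have "compact ?T"
      by (simp add: compact_Int_closed)
    moreover have "continuous_on ?T (\<lambda>x. x \<bullet> p)"
      by (intro continuous_intros)
    ultimately obtain z where z: "z \<in> ?T" "\<And>x. x \<in> ?T \<Longrightarrow> z \<bullet> p \<le> x \<bullet> p"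
      using continuous_attains_inf[OF _ False] by blast
    then have zr: "norm z = r" "c \<le> u z" "z \<in> sphere 0 r"
      by auto
    define \<rho> where "\<rho> = arccos (z \<bullet> p / r)"
    have "r * arccos (x \<bullet> p / r) \<le> r * \<rho> \<longleftrightarrow> x \<in> ?T" if x: "x \<in> sphere 0 r" for x
    proof -
      have "r * arccos (x \<bullet> p / r) \<le> r * \<rho> \<longleftrightarrow> z \<bullet> p / r \<le> x \<bullet> p / r"
        using r bound[OF x] bound[OF zr(3)] by (simp add: \<rho>_def arccos_le_mono)
      also have "\<dots> \<longleftrightarrow> z \<bullet> p \<le> x \<bullet> p"
        using r by (simp add: divide_le_cancel)
      also have "\<dots> \<longleftrightarrow> x \<in> ?T"
      proof
        assume "z \<bullet> p \<le> x \<bullet> p"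
        then have "u z \<le> u x"
          using x zr by (intro mono) simp_all
        with x zr show "x \<in> ?T" by simp
      qed (rule z(2))
      finally show ?thesis .
    qed
    then have "?T = {x \<in> sphere 0 r. r * arccos (x \<bullet> p / r) \<le> r * \<rho>}"
      by blast
    then have "geodesic_ball r p \<rho> ?T"
      unfolding geodesic_ball_def by (rule disjI2)
    moreover have "0 \<le> \<rho>"
      using bound[OF zr(3)] unfolding \<rho>_def abs_le_iff by (intro arccos_lbound) linarith+
    ultimately show ?thesis by blast
  qed
qed

context fractional_problem
begin

lemma foliated_schwarz_symmetric:
  assumes e1: "norm e1 = 1" "\<And>x. x \<bullet> e1 > 0 \<Longrightarrow> 0 \<le> refl_diff e1 x"
    and x1: "x1 \<bullet> e1 > 0" "0 < refl_diff e1 x1"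
  shows "foliated_schwarz_symmetric \<Omega> u"
proof -
  have m: "moment \<noteq> 0"
    using moment_inner_pos[OF e1 x1] by auto
  have closed_hemisphere: "0 \<le> refl_diff e x" if e: "norm e = 1" "0 \<le> moment \<bullet> e" and x: "x \<bullet> e > 0" for e x
  proof (cases "moment \<bullet> e = 0")
    case False
    with e x show ?thesis
      by (intro refl_diff_nonneg_hemisphere[OF e1 x1]) auto
  next
    case True
    \<comment> \<open>Directions orthogonal to \<open>moment\<close>, which arise from two points at
      the same height, are limits of directions in the open hemisphere: pushing \<open>e\<close>
      towards \<open>moment\<close> makes the inner product positive.\<close>
    define v where "v = (\<lambda>n. e + (1 / real (Suc n)) *\<^sub>R moment)"
    have v_inner: "0 < moment \<bullet> v n" for n
      using True m by (simp add: v_def inner_add_right)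
    then have v0: "v n \<noteq> 0" for n
      by (metis inner_zero_right less_irrefl)
    have "v \<longlonglongrightarrow> e + 0 *\<^sub>R moment"
      unfolding v_def by (intro tendsto_intros LIMSEQ_Suc lim_1_over_n)
    then have "v \<longlonglongrightarrow> e" by simp
    then have "(\<lambda>n. v n /\<^sub>R norm (v n)) \<longlonglongrightarrow> e /\<^sub>R norm e"
      by (intro tendsto_intros) (use e in auto)
    then have "(\<lambda>n. v n /\<^sub>R norm (v n)) \<longlonglongrightarrow> e"
      using e by simp
    moreover have "0 \<le> refl_diff (v n /\<^sub>R norm (v n)) x" if "x \<bullet> (v n /\<^sub>R norm (v n)) > 0" for n x
      using that v_inner[of n] v0[of n] by (intro refl_diff_nonneg_hemisphere[OF e1 x1]) auto
    ultimately show ?thesis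
      using x by (rule refl_diff_nonneg_limit)
  qed
  show ?thesis
  proof (rule foliated_schwarz_symmetricI[OF u_cont])
    show "norm (moment /\<^sub>R norm moment) = 1"
      using m by simp
    fix x y :: 'a
    assume eq: "norm x = norm y" and "y \<bullet> (moment /\<^sub>R norm moment) \<le> x \<bullet> (moment /\<^sub>R norm moment)"
    then have le: "y \<bullet> moment \<le> x \<bullet> moment"
      using m by simp
    show "u y \<le> u x"
    proof (cases "x = y")
      case False
      \<comment> \<open>The direction whose reflection maps \<open>x\<close> to \<open>y\<close>;
        the order of the heights says that it lies in the closed hemisphere.\<close>
      let ?e = "(x - y) /\<^sub>R norm (x - y)"
      have "0 \<le> refl_diff ?e x"
        using False le by (intro closed_hemisphere refl_hp_normalized_diff(2)[OF eq False])
          (simp_all add: inner_diff_right inner_commute)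
      then show ?thesis
        by (simp add: refl_diff_def refl_hp_normalized_diff(1)[OF eq False])
    qed simp
  qed
qed

end

theorem theorem1p1:
  fixes \<Omega> :: "'a::euclidean_space set"
    and s :: real
    and f :: "real \<Rightarrow> real \<Rightarrow> real"
    and u :: "'a \<Rightarrow> real"
    and e1 :: 'a
  assumes "DIM('a) \<ge> 2"
    and "open \<Omega>" and "bounded \<Omega>" and "radial_set \<Omega>"
    and "0 < s" and "s < 1"
    and "\<forall>K>0. \<exists>L>0. \<forall>v w. \<bar>v\<bar> \<le> K \<longrightarrow> \<bar>w\<bar> \<le> K \<longrightarrow>
            (\<forall>r\<ge>0. \<bar>f r v - f r w\<bar> \<le> L * \<bar>v - w\<bar>)"
    and "continuous_on UNIV u" and "bounded (range u)"
    and "weak_solution s \<Omega> f u"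
    and "(u \<longlongrightarrow> 0) at_infinity"
    and "norm e1 = 1"
    and "\<forall>x. x \<bullet> e1 > 0 \<longrightarrow> u (refl_hp e1 x) \<le> u x"
    and "\<exists>x. x \<bullet> e1 > 0 \<and> u x \<noteq> u (refl_hp e1 x)"
  shows "foliated_schwarz_symmetric \<Omega> u"
proof -
  obtain K where K: "0 < K" "\<And>x. \<bar>u x\<bar> \<le> K"
    using \<open>bounded (range u)\<close> unfolding bounded_pos by auto
  obtain L where L: "0 < L" "\<forall>v w. \<bar>v\<bar> \<le> K \<longrightarrow> \<bar>w\<bar> \<le> K \<longrightarrow> (\<forall>r\<ge>0. \<bar>f r v - f r w\<bar> \<le> L * \<bar>v - w\<bar>)"
    using assms(7)[rule_format, OF K(1)] by auto
  interpret fractional_problem \<Omega> s f u L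
  proof
    show "\<bar>f r (u x) - f r (u y)\<bar> \<le> L * \<bar>u x - u y\<bar>" if "0 \<le> r" for r x y
      using L(2) K(2) that by blast
  qed (use L(1) in \<open>simp_all only: assms less_imp_le\<close>)
  obtain x1 where x1: "x1 \<bullet> e1 > 0" "u x1 \<noteq> u (refl_hp e1 x1)"
    using assms(14) by blast
  show ?thesis
  proof (rule foliated_schwarz_symmetric)
    show "norm e1 = 1" by fact
    show "0 \<le> refl_diff e1 x" if "x \<bullet> e1 > 0" for x
      using assms(13) that by (simp add: refl_diff_def)
    show "x1 \<bullet> e1 > 0" by fact
    show "0 < refl_diff e1 x1"
      using assms(13) x1 by (simp add: refl_diff_def order_less_le)
  qed
qed

end
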